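(* The category $\mathcal{VA}_{\mathcal{L}}$ of $\mathcal{L}$-$\mathcal{VL}$-algebras is dually equivalent to the category $PBS_{\mathcal{L}}$, via the functors $F:PBS_{\mathcal{L}}\to\mathcal{VA}_{\mathcal{L}}$ and $G:\mathcal{VA}_{\mathcal{L}}\to PBS_{\mathcal{L}}$, with natural isomorphisms $\beta^{\mathcal{A}}:\mathcal{A}\to F(G(\mathcal{A}))$, $\beta^{\mathcal{A}}(a)(\phi)=\phi(a)$, and $\zeta_{(\mathcal{S},\alpha_{\mathcal{S}})}:(\mathcal{S},\alpha_{\mathcal{S}})\to G(F(\mathcal{S},\alpha_{\mathcal{S}}))$, $\zeta_{(\mathcal{S},\alpha_{\mathcal{S}})}(s)(\psi)=\psi(s)$ (the latter being a bi-homeomorphism, i.e. a bijection which is pairwise continuous with pairwise continuous inverse).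
   Context: $\mathcal{L}$ is a finite bounded distributive lattice, hence a Heyting algebra. An $\mathcal{L}$-$\mathcal{VL}$-algebra is a structure $(\mathcal{A},\wedge,\vee,\to,(T_\ell)_{\ell\in\mathcal{L}},0,1)$, with unary operations $T_\ell$, such that for all $\ell,\ell_1,\ell_2\in\mathcal{L}$ and $a,b\in\mathcal{A}$: (i) $(\mathcal{A},\wedge,\vee,\to,0,1)$ is a Heyting algebra; (ii) $T_{\ell_1}(a)\wedge T_{\ell_2}(b)\le T_{\ell_1\to\ell_2}(a\to b)\wedge T_{\ell_1\wedge\ell_2}(a\wedge b)\wedge T_{\ell_1\vee\ell_2}(a\vee b)$ and $T_{\ell_2}(a)\le T_{T_{\ell_1}(\ell_2)}(T_{\ell_1}(a))$; (iii) $T_0(0)=1$, $T_\ell(0)=0$ for $\ell\neq0$, $T_1(1)=1$, $T_\ell(1)=0$ for $\ell\ne1$; (iv) $\bigvee_{\ell\in\mathcal{L}}T_\ell(a)=1$, $T_\ell(a)\vee(T_\ell(a)\to0)=1$, and $T_{\ell_1}(a)\wedge T_{\ell_2}(a)=0$ for $\ell_1\ne\ell_2$; (v) $T_1(T_\ell(a))=T_\ell(a)$, $T_0(T_\ell(a))=T_\ell(a)\to0$, $T_{\ell_2}(T_{\ell_1}(a))=0$ for $\ell_2\neq0,1$; (vi) $T_1(a)\le a$, $T_1(a\wedge b)=T_1(a)\wedge T_1(b)$; (vii) $\bigwedge_{\ell\in\mathcal{L}}(T_\ell(a)\leftrightarrow T_\ell(b))\le(a\leftrightarrow b)$. $\mathcal{L}$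 itself is regarded as an $\mathcal{L}$-$\mathcal{VL}$-algebra with its Heyting operations and $T_\ell(x)=1$ if $x=\ell$, $T_\ell(x)=0$ otherwise; $\Sigma_{\mathcal{L}}$ denotes the set of subalgebras of $\mathcal{L}$. $\mathcal{VA}_{\mathcal{L}}$ is the category of $\mathcal{L}$-$\mathcal{VL}$-algebras and homomorphisms. A bitopological space $(S,\tau_1,\tau_2)$ is pairwise Boolean if it is pairwise Hausdorff (distinct $s_1,s_2$ have disjoint neighbourhoods $O_1\in\tau_1\ni s_1$, $O_2\in\tau_2\ni s_2$), pairwise zero-dimensional ($\tau_1$-open $\tau_2$-closed sets form a basis of $\tau_1$ and $\tau_2$-open $\tau_1$-closed sets form a basis of $\tau_2$) and pairwise compact (every cover by sets of $\tau_1\cup\tau_2$ has a finite subcover). A subset is pairwise closed if it is closed in both topologies; $\Omega_{\mathcal{B}}$ is the set of pairwise closed subsets of $\mathcal{B}$. A map is pairwise continuous if it is continuous for the first topologies and for the second topologies. The category $PBS_{\mathcal{L}}$: objects are pairs $(\mathcal{B},\alpha_{\mathcal{B}})$ with $\mathcal{B}$ a pairwise Boolean space and $\alpha_{\mathcal{B}}:\Sigma_{\mathcal{L}}\to\Omega_{\mathcal{B}}$ such that $\alpha_{\mathcal{B}}(\mathcal{L})=\mathcal{B}$ and $\alpha_{\mathcal{B}}(\mathcal{L}_2\cap\mathcal{L}_3)=\alpha_{\mathcal{B}}(\mathcal{L}_2)\cap\alpha_{\mathcal{B}}(\mathcal{L}_3)$; morphisms $f:(\mathcal{B},\alpha_{\mathcal{B}})\to(\mathcal{B}',\alpha_{\mathcal{B}'})$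 are pairwise continuous maps with $f(\alpha_{\mathcal{B}}(\mathcal{L}'))\subseteq\alpha_{\mathcal{B}'}(\mathcal{L}')$ for all $\mathcal{L}'\in\Sigma_{\mathcal{L}}$. $(\mathcal{L},\alpha_{\mathcal{L}})$ is $\mathcal{L}$ with the discrete topology as both topologies and $\alpha_{\mathcal{L}}(\mathcal{L}')=\mathcal{L}'$. The functor $F$: $F(\mathcal{B},\alpha_{\mathcal{B}})=\mathrm{Hom}_{PBS_{\mathcal{L}}}((\mathcal{B},\alpha_{\mathcal{B}}),(\mathcal{L},\alpha_{\mathcal{L}}))$ with $\vee,\wedge,\to,T_p$ defined pointwise and $0,1$ constant; $F(\phi)(\eta)=\eta\circ\phi$. The functor $G$: $G(\mathcal{A})=(\mathrm{Hom}_{\mathcal{VA}_{\mathcal{L}}}(\mathcal{A},\mathcal{L}),\sigma_1,\sigma_2,\alpha_{\mathcal{A}})$, where $\sigma_1$ has basis $\{\langle a\rangle:a\in\mathcal{A}\}$ with $\langle a\rangle=\{v:v(a)=1\}$, $\sigma_2$ has basis $\{\langle a\rangle^c:a\in\mathcal{A}\}$, and $\alpha_{\mathcal{A}}(\mathcal{L}')=\mathrm{Hom}_{\mathcal{VA}_{\mathcal{L}}}(\mathcal{A},\mathcal{L}')$; $G(g)(\mu)=\mu\circ g$.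
   Formalization: The lattice L is assumed nontrivial (0 ≠ 1); for one-element L every algebra is trivial while PBS_L contains spaces with several points, and the prescribed basis of σ_2 does not cover Hom(A, L), so the claim fails there. *)

theory Defs
  imports "HOL-Analysis.Analysis"
begin

definition himpL :: "'l::finite_distrib_lattice \<Rightarrow> 'l \<Rightarrow> 'l" where
  "himpL x y = Sup {z. inf z x \<le> y}"

definition TL :: "'l::finite_distrib_lattice \<Rightarrow> 'l \<Rightarrow> 'l" where
  "TL p x = (if x = p then top else bot)"

record ('l, 'a) vl_struct =
  vcarrier :: "'a set"
  vmeet :: "'a \<Rightarrow> 'a \<Rightarrow> 'a"
  vjoin :: "'a \<Rightarrow> 'a \<Rightarrow> 'a"
  vimp  :: "'a \<Rightarrow> 'a \<Rightarrow> 'a"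
  vT    :: "'l \<Rightarrow> 'a \<Rightarrow> 'a"
  vzero :: "'a"
  vone  :: "'a"

definition vle :: "('l, 'a) vl_struct \<Rightarrow> 'a \<Rightarrow> 'a \<Rightarrow> bool" where
  "vle A x y \<longleftrightarrow> vmeet A x y = x"

definition viff :: "('l, 'a) vl_struct \<Rightarrow> 'a \<Rightarrow> 'a \<Rightarrow> 'a" where
  "viff A x y = vmeet A (vimp A x y) (vimp A y x)"

definition lvals :: "'l::finite list" where
  "lvals = (SOME xs. distinct xs \<and> set xs = UNIV)"

definition vBigJoin :: "('l::finite, 'a) vl_struct \<Rightarrow> ('l \<Rightarrow> 'a) \<Rightarrow> 'a" where
  "vBigJoin A f = foldr (vjoin A) (map f lvals) (vzero A)"

definition vBigMeet :: "('l::finite, 'a) vl_struct \<Rightarrow> ('l \<Rightarrow> 'a) \<Rightarrow> 'a" where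
  "vBigMeet A f = foldr (vmeet A) (map f lvals) (vone A)"

definition heyting_alg :: "('l, 'a) vl_struct \<Rightarrow> bool" where
  "heyting_alg A \<longleftrightarrow>
     vzero A \<in> vcarrier A \<and> vone A \<in> vcarrier A \<and>
     (\<forall>x\<in>vcarrier A. \<forall>y\<in>vcarrier A.
        vmeet A x y \<in> vcarrier A \<and> vjoin A x y \<in> vcarrier A \<and> vimp A x y \<in> vcarrier A) \<and>
     (\<forall>x\<in>vcarrier A. \<forall>y\<in>vcarrier A.
        vmeet A x y = vmeet A y x \<and> vjoin A x y = vjoin A y x \<and>
        vmeet A x (vjoin A x y) = x \<and> vjoin A x (vmeet A x y) = x) \<and>
     (\<forall>x\<in>vcarrier A. \<forall>y\<in>vcarrier A. \<forall>z\<in>vcarrier A.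
        vmeet A x (vmeet A y z) = vmeet A (vmeet A x y) z \<and>
        vjoin A x (vjoin A y z) = vjoin A (vjoin A x y) z) \<and>
     (\<forall>x\<in>vcarrier A. vmeet A (vzero A) x = vzero A \<and> vmeet A (vone A) x = x) \<and>
     (\<forall>x\<in>vcarrier A. \<forall>y\<in>vcarrier A. \<forall>z\<in>vcarrier A.
        vle A (vmeet A z x) y \<longleftrightarrow> vle A z (vimp A x y))"

definition vl_alg :: "('l::finite_distrib_lattice, 'a) vl_struct \<Rightarrow> bool" where
  "vl_alg A \<longleftrightarrow>
     heyting_alg A \<and>
     (\<forall>l. \<forall>x\<in>vcarrier A. vT A l x \<in> vcarrier A) \<and>
     \<comment> \<open>(ii)\<close>
     (\<forall>l1 l2. \<forall>a\<in>vcarrier A. \<forall>b\<in>vcarrier A.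
        vle A (vmeet A (vT A l1 a) (vT A l2 b))
              (vmeet A (vT A (himpL l1 l2) (vimp A a b))
                 (vmeet A (vT A (inf l1 l2) (vmeet A a b)) (vT A (sup l1 l2) (vjoin A a b))))
      \<and> vle A (vT A l2 a) (vT A (TL l1 l2) (vT A l1 a))) \<and>
     \<comment> \<open>(iii)\<close>
     vT A bot (vzero A) = vone A \<and> (\<forall>l. l \<noteq> bot \<longrightarrow> vT A l (vzero A) = vzero A) \<and>
     vT A top (vone A) = vone A \<and> (\<forall>l. l \<noteq> top \<longrightarrow> vT A l (vone A) = vzero A) \<and>
     \<comment> \<open>(iv)\<close>
     (\<forall>a\<in>vcarrier A.
        vBigJoin A (\<lambda>l. vT A l a) = vone A \<and>
        (\<forall>l. vjoin A (vT A l a) (vimp A (vT A l a) (vzero A)) = vone A) \<and>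
        (\<forall>l1 l2. l1 \<noteq> l2 \<longrightarrow> vmeet A (vT A l1 a) (vT A l2 a) = vzero A)) \<and>
     \<comment> \<open>(v)\<close>
     (\<forall>a\<in>vcarrier A. \<forall>l.
        vT A top (vT A l a) = vT A l a \<and>
        vT A bot (vT A l a) = vimp A (vT A l a) (vzero A) \<and>
        (\<forall>l2. l2 \<noteq> bot \<and> l2 \<noteq> top \<longrightarrow> vT A l2 (vT A l a) = vzero A)) \<and>
     \<comment> \<open>(vi)\<close>
     (\<forall>a\<in>vcarrier A. \<forall>b\<in>vcarrier A.
        vle A (vT A top a) a \<and> vT A top (vmeet A a b) = vmeet A (vT A top a) (vT A top b)) \<and>
     \<comment> \<open>(vii)\<close>
     (\<forall>a\<in>vcarrier A. \<forall>b\<in>vcarrier A.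
        vle A (vBigMeet A (\<lambda>l. viff A (vT A l a) (vT A l b))) (viff A a b))"

definition vhom :: "('l, 'a) vl_struct \<Rightarrow> ('l, 'b) vl_struct \<Rightarrow> ('a \<Rightarrow> 'b) set" where
  "vhom A B = {f. f \<in> vcarrier A \<rightarrow>\<^sub>E vcarrier B \<and>
     (\<forall>x\<in>vcarrier A. \<forall>y\<in>vcarrier A.
        f (vmeet A x y) = vmeet B (f x) (f y) \<and> f (vjoin A x y) = vjoin B (f x) (f y) \<and>
        f (vimp A x y) = vimp B (f x) (f y)) \<and>
     (\<forall>l. \<forall>x\<in>vcarrier A. f (vT A l x) = vT B l (f x)) \<and>
     f (vzero A) = vzero B \<and> f (vone A) = vone B}"

definition L_alg :: "('l::finite_distrib_lattice, 'l) vl_struct" where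
  "L_alg = \<lparr>vcarrier = UNIV, vmeet = inf, vjoin = sup, vimp = himpL, vT = TL,
            vzero = bot, vone = top\<rparr>"

definition SigmaL :: "'l::finite_distrib_lattice set set" where
  "SigmaL = {S. bot \<in> S \<and> top \<in> S \<and>
     (\<forall>x\<in>S. \<forall>y\<in>S. inf x y \<in> S \<and> sup x y \<in> S \<and> himpL x y \<in> S) \<and>
     (\<forall>p. \<forall>x\<in>S. TL p x \<in> S)}"

definition pairwise_hausdorff :: "'b topology \<Rightarrow> 'b topology \<Rightarrow> bool" where
  "pairwise_hausdorff t1 t2 \<longleftrightarrow>
     (\<forall>s1\<in>topspace t1. \<forall>s2\<in>topspace t1. s1 \<noteq> s2 \<longrightarrow>
        (\<exists>O1 O2. openin t1 O1 \<and> openin t2 O2 \<and> s1 \<in> O1 \<and> s2 \<in> O2 \<and> O1 \<inter> O2 = {}))"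

definition pairwise_zero_dim :: "'b topology \<Rightarrow> 'b topology \<Rightarrow> bool" where
  "pairwise_zero_dim t1 t2 \<longleftrightarrow>
     (\<forall>U x. openin t1 U \<and> x \<in> U \<longrightarrow>
        (\<exists>V. openin t1 V \<and> closedin t2 V \<and> x \<in> V \<and> V \<subseteq> U)) \<and>
     (\<forall>U x. openin t2 U \<and> x \<in> U \<longrightarrow>
        (\<exists>V. openin t2 V \<and> closedin t1 V \<and> x \<in> V \<and> V \<subseteq> U))"

definition pairwise_compact :: "'b topology \<Rightarrow> 'b topology \<Rightarrow> bool" where
  "pairwise_compact t1 t2 \<longleftrightarrow>
     (\<forall>\<U>. (\<forall>U\<in>\<U>. openin t1 U \<or> openin t2 U) \<and> topspace t1 \<subseteq> \<Union>\<U> \<longrightarrow>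
        (\<exists>\<V>\<subseteq>\<U>. finite \<V> \<and> topspace t1 \<subseteq> \<Union>\<V>))"

definition pairwise_boolean :: "'b topology \<Rightarrow> 'b topology \<Rightarrow> bool" where
  "pairwise_boolean t1 t2 \<longleftrightarrow>
     topspace t1 = topspace t2 \<and>
     pairwise_hausdorff t1 t2 \<and> pairwise_zero_dim t1 t2 \<and> pairwise_compact t1 t2"

definition pairwise_closed :: "'b topology \<Rightarrow> 'b topology \<Rightarrow> 'b set \<Rightarrow> bool" where
  "pairwise_closed t1 t2 X \<longleftrightarrow> closedin t1 X \<and> closedin t2 X"

record ('l, 'b) pbs =
  ptop1 :: "'b topology"
  ptop2 :: "'b topology"
  palpha :: "'l set \<Rightarrow> 'b set"

abbreviation pspace :: "('l, 'b) pbs \<Rightarrow> 'b set" where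
  "pspace B \<equiv> topspace (ptop1 B)"

definition pbs_obj :: "('l::finite_distrib_lattice, 'b) pbs \<Rightarrow> bool" where
  "pbs_obj B \<longleftrightarrow>
     pairwise_boolean (ptop1 B) (ptop2 B) \<and>
     (\<forall>L'\<in>SigmaL. pairwise_closed (ptop1 B) (ptop2 B) (palpha B L')) \<and>
     palpha B UNIV = pspace B \<and>
     (\<forall>L2\<in>SigmaL. \<forall>L3\<in>SigmaL. palpha B (L2 \<inter> L3) = palpha B L2 \<inter> palpha B L3)"

definition pbs_hom :: "('l::finite_distrib_lattice, 'b) pbs \<Rightarrow> ('l, 'c) pbs \<Rightarrow> ('b \<Rightarrow> 'c) set" where
  "pbs_hom B C = {f. f \<in> pspace B \<rightarrow>\<^sub>E pspace C \<and>
     continuous_map (ptop1 B) (ptop1 C) f \<and> continuous_map (ptop2 B) (ptop2 C) f \<and>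
     (\<forall>L'\<in>SigmaL. f ` palpha B L' \<subseteq> palpha C L')}"

definition L_pbs :: "('l::finite_distrib_lattice, 'l) pbs" where
  "L_pbs = \<lparr>ptop1 = discrete_topology UNIV, ptop2 = discrete_topology UNIV, palpha = id\<rparr>"

definition Fobj :: "('l::finite_distrib_lattice, 'b) pbs \<Rightarrow> ('l, 'b \<Rightarrow> 'l) vl_struct" where
  "Fobj B = \<lparr>vcarrier = pbs_hom B L_pbs,
     vmeet = (\<lambda>f g. \<lambda>s\<in>pspace B. inf (f s) (g s)),
     vjoin = (\<lambda>f g. \<lambda>s\<in>pspace B. sup (f s) (g s)),
     vimp = (\<lambda>f g. \<lambda>s\<in>pspace B. himpL (f s) (g s)),
     vT = (\<lambda>p f. \<lambda>s\<in>pspace B. TL p (f s)),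
     vzero = (\<lambda>s\<in>pspace B. bot),
     vone = (\<lambda>s\<in>pspace B. top)\<rparr>"

definition Fmor :: "('l::finite_distrib_lattice, 'b) pbs \<Rightarrow> ('l, 'c) pbs \<Rightarrow> ('b \<Rightarrow> 'c)
                     \<Rightarrow> ('c \<Rightarrow> 'l) \<Rightarrow> ('b \<Rightarrow> 'l)" where
  "Fmor B C \<phi> = (\<lambda>\<eta>\<in>vcarrier (Fobj C). \<lambda>s\<in>pspace B. \<eta> (\<phi> s))"

definition basic_open :: "('l::finite_distrib_lattice, 'a) vl_struct \<Rightarrow> 'a \<Rightarrow> ('a \<Rightarrow> 'l) set" where
  "basic_open A a = {v \<in> vhom A L_alg. v a = top}"

definition Gobj :: "('l::finite_distrib_lattice, 'a) vl_struct \<Rightarrow> ('l, 'a \<Rightarrow> 'l) pbs" where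
  "Gobj A = \<lparr>ptop1 = topology_generated_by ((\<lambda>a. basic_open A a) ` vcarrier A),
     ptop2 = topology_generated_by ((\<lambda>a. vhom A L_alg - basic_open A a) ` vcarrier A),
     palpha = (\<lambda>L'. {v \<in> vhom A L_alg. v ` vcarrier A \<subseteq> L'})\<rparr>"

definition Gmor :: "('l::finite_distrib_lattice, 'a) vl_struct \<Rightarrow> ('l, 'c) vl_struct \<Rightarrow> ('a \<Rightarrow> 'c)
                     \<Rightarrow> ('c \<Rightarrow> 'l) \<Rightarrow> ('a \<Rightarrow> 'l)" where
  "Gmor A C g = (\<lambda>\<mu>\<in>vhom C L_alg. \<lambda>a\<in>vcarrier A. \<mu> (g a))"

definition beta :: "('l::finite_distrib_lattice, 'a) vl_struct \<Rightarrow> 'a \<Rightarrow> (('a \<Rightarrow> 'l) \<Rightarrow> 'l)" where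
  "beta A = (\<lambda>a\<in>vcarrier A. \<lambda>\<phi>\<in>vhom A L_alg. \<phi> a)"

definition zeta :: "('l::finite_distrib_lattice, 'b) pbs \<Rightarrow> 'b \<Rightarrow> (('b \<Rightarrow> 'l) \<Rightarrow> 'l)" where
  "zeta B = (\<lambda>s\<in>pspace B. \<lambda>\<psi>\<in>pbs_hom B L_pbs. \<psi> s)"

end

theory Submission
  imports Defs
begin

text \<open>
  The two topologies of a pairwise Boolean space coincide, so such a space is a Stone space, and on
  \<open>G(A)\<close> they coincide because the complement of \<open>\<langle>a\<rangle>\<close> is \<open>\<langle>T_1 a \<rightarrow> 0\<rangle>\<close>. \<open>Hom(A, L)\<close> is compact as a closed
  subset of \<open>L^A\<close>. An ultrafilter \<open>P\<close> of \<open>A\<close> gives the homomorphism sending \<open>a\<close> to the unique \<open>l\<close> with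
  \<open>T_l a \<in> P\<close>; by axiom (vii) these separate points, so \<open>\<beta>\<close> is injective. It is surjective because a
  morphism \<open>f\<close> satisfies \<open>f v \<in> v(A)\<close>, hence agrees locally with elements of \<open>A\<close>, and compactness
  lets one glue finitely many of them using the Boolean elements \<open>T_1 b\<close>. Step functions on clopen
  sets show that \<open>\<zeta>\<close> is injective and reflects \<open>\<alpha>\<close>; compactness gives surjectivity, and a continuous
  bijection from a compact space onto a Hausdorff space is a homeomorphism.
\<close>

section \<open>Heyting implication and subalgebras of the lattice L\<close>

lemma inf_le_iff_le_himpL: "inf z x \<le> y \<longleftrightarrow> z \<le> himpL x y"
proof
  show "z \<le> himpL x y" if "inf z x \<le> y"
    unfolding himpL_def using that by (simp add: Sup_upper)
  \<comment> \<open>Distributivity over finite suprema moves the meet with \<open>x\<close> inside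
    the supremum that defines \<open>himpL x y\<close>.\<close>
  have "inf x (himpL x y) \<le> y"
    unfolding himpL_def finite_inf_Sup by (rule Sup_least) (auto simp: inf_commute)
  moreover assume "z \<le> himpL x y"
  ultimately show "inf z x \<le> y"
    by (metis inf.commute inf_mono order_refl order_trans)
qed

lemma himpL_eq_top_iff: "himpL x y = top \<longleftrightarrow> x \<le> y"
  using inf_le_iff_le_himpL[of top x y] by (simp add: top_unique)

lemma himpL_refl [simp]: "himpL x x = top"
  by (simp add: himpL_eq_top_iff)

lemma himpL_top_left [simp]: "himpL top y = y"
  by (metis inf_le_iff_le_himpL inf_top_right order_antisym order_refl)

lemma UNIV_in_SigmaL: "UNIV \<in> SigmaL"
  by (simp add: SigmaL_def)

lemma SigmaL_Int: "S \<in> SigmaL \<Longrightarrow> T \<in> SigmaL \<Longrightarrow> S \<inter> T \<in> SigmaL"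
  by (auto simp: SigmaL_def)

lemma SigmaLD:
  assumes "S \<in> SigmaL"
  shows "bot \<in> S" "top \<in> S" "TL p x \<in> S"
    "x \<in> S \<Longrightarrow> y \<in> S \<Longrightarrow> inf x y \<in> S"
    "x \<in> S \<Longrightarrow> y \<in> S \<Longrightarrow> sup x y \<in> S"
    "x \<in> S \<Longrightarrow> y \<in> S \<Longrightarrow> himpL x y \<in> S"
  using assms by (auto simp: SigmaL_def TL_def)

lemma set_lvals: "set (lvals :: 'l::finite list) = UNIV"
proof -
  obtain xs :: "'l list" where "distinct xs \<and> set xs = UNIV"
    using finite_distinct_list[of "UNIV :: 'l set"] by auto
  then show ?thesis
    unfolding lvals_def by (rule someI2) simp
qed

section \<open>Locally constant maps and Stone spaces\<close>

text \<open>Any preimage is the union of the fibres over its points, so it is enough that fibres are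
  open.\<close>

lemma continuous_map_discrete_iff:
  "continuous_map X (discrete_topology UNIV) f \<longleftrightarrow> (\<forall>l. openin X {x \<in> topspace X. f x = l})"
proof
  assume "continuous_map X (discrete_topology UNIV) f"
  then show "\<forall>l. openin X {x \<in> topspace X. f x = l}"
    using openin_continuous_map_preimage[of X "discrete_topology UNIV" f "{l}" for l] by simp
next
  assume op: "\<forall>l. openin X {x \<in> topspace X. f x = l}"
  have "openin X {x \<in> topspace X. f x \<in> U}" for U
  proof -
    have "{x \<in> topspace X. f x \<in> U} = (\<Union>l\<in>U. {x \<in> topspace X. f x = l})" by blast
    then show ?thesis using op by auto
  qed
  then show "continuous_map X (discrete_topology UNIV) f"
    by (simp add: continuous_map)
qed

text \<open>Each fibre of the combined map is a union of intersections of a fibre of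
  \<open>f\<close> with a fibre of \<open>g\<close>.\<close>

lemma continuous_map_discrete_binop:
  assumes "continuous_map X (discrete_topology UNIV) f" "continuous_map X (discrete_topology UNIV) g"
  shows "continuous_map X (discrete_topology UNIV) (\<lambda>x. h (f x) (g x))"
  unfolding continuous_map_discrete_iff
proof
  fix l
  have "{x \<in> topspace X. h (f x) (g x) = l} =
     (\<Union>(p, q)\<in>{(p, q). h p q = l}. {x \<in> topspace X. f x = p} \<inter> {x \<in> topspace X. g x = q})"
    by blast
  moreover have "openin X \<dots>"
    using assms unfolding continuous_map_discrete_iff by (intro openin_Union) auto
  ultimately show "openin X {x \<in> topspace X. h (f x) (g x) = l}" by simp
qed

text \<open>The equaliser is the fibre over \<open>True\<close> of a continuous map into the
  discrete space of truth values.\<close>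

lemma continuous_map_discrete_eq_clopen:
  assumes "continuous_map X (discrete_topology UNIV) f" "continuous_map X (discrete_topology UNIV) g"
  shows "openin X {x \<in> topspace X. f x = g x}" "closedin X {x \<in> topspace X. f x = g x}"
proof -
  have c: "continuous_map X (discrete_topology UNIV) (\<lambda>x. f x = g x)"
    by (rule continuous_map_discrete_binop[OF assms])
  from openin_continuous_map_preimage[OF c, of "{True}"]
  show "openin X {x \<in> topspace X. f x = g x}" by simp
  from closedin_continuous_map_preimage[OF c, of "{True}"]
  show "closedin X {x \<in> topspace X. f x = g x}" by simp
qed

text \<open>Given \<open>x\<close> in \<open>U\<close>, every other point has a
  \<open>t1\<close>-open neighbourhood that misses some \<open>t2\<close>-neighbourhood of
  \<open>x\<close>. These sets together with \<open>U\<close> cover the space; the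
  \<open>t2\<close>-neighbourhoods belonging to a finite subcover intersect in a neighbourhood of
  \<open>x\<close> inside \<open>U\<close>.\<close>

lemma pairwise_hausdorff_compact_finer:
  assumes sp: "topspace t1 = topspace t2" and cp: "pairwise_compact t1 t2"
    and H: "\<And>x y. x \<in> topspace t1 \<Longrightarrow> y \<in> topspace t1 \<Longrightarrow> x \<noteq> y \<Longrightarrow>
       \<exists>O1 O2. openin t1 O1 \<and> openin t2 O2 \<and> y \<in> O1 \<and> x \<in> O2 \<and> O1 \<inter> O2 = {}"
    and U: "openin t1 U"
  shows "openin t2 U"
proof (subst openin_subopen, intro ballI)
  fix x assume x: "x \<in> U"
  define \<W> where "\<W> = {W. openin t1 W \<and> (\<exists>O2. openin t2 O2 \<and> x \<in> O2 \<and> W \<inter> O2 = {})}"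
  have "topspace t1 \<subseteq> \<Union>(insert U \<W>)"
  proof
    fix y assume y: "y \<in> topspace t1"
    show "y \<in> \<Union>(insert U \<W>)"
    proof (cases "y = x")
      case False
      then obtain O1 O2 where "openin t1 O1" "openin t2 O2" "y \<in> O1" "x \<in> O2" "O1 \<inter> O2 = {}"
        using H[of x y] x y openin_subset[OF U] by blast
      then show ?thesis unfolding \<W>_def by blast
    qed (use x in auto)
  qed
  moreover have "\<forall>W\<in>insert U \<W>. openin t1 W \<or> openin t2 W"
    using U by (auto simp: \<W>_def)
  ultimately obtain \<V> where \<V>: "\<V> \<subseteq> insert U \<W>" "finite \<V>" "topspace t1 \<subseteq> \<Union>\<V>"
    using cp unfolding pairwise_compact_def by meson
  have "\<forall>W\<in>\<V> - {U}. \<exists>O2. openin t2 O2 \<and> x \<in> O2 \<and> W \<inter> O2 = {}"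
    using \<V>(1) by (auto simp: \<W>_def)
  then obtain N where N: "\<And>W. W \<in> \<V> - {U} \<Longrightarrow> openin t2 (N W) \<and> x \<in> N W \<and> W \<inter> N W = {}"
    by metis
  \<comment> \<open>The factor \<open>topspace t2\<close> handles the case where the subcover
    contains at most \<open>U\<close>: the intersection over the empty family is
    \<open>UNIV\<close>, which need not be open.\<close>
  define T where "T = topspace t2 \<inter> \<Inter>(N ` (\<V> - {U}))"
  have "openin t2 T"
  proof (cases "\<V> - {U} = {}")
    case False
    then have "openin t2 (\<Inter>(N ` (\<V> - {U})))"
      using \<V>(2) N by (intro openin_Inter) auto
    then show ?thesis unfolding T_def by blast
  next
    case True
    then show ?thesis
      by (simp only: T_def image_empty Inter_empty Int_UNIV_right openin_topspace)
  qed
  moreover have "x \<in> T"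
    using N x openin_subset[OF U] sp unfolding T_def by auto
  moreover have "T \<subseteq> U"
  proof
    fix y assume y: "y \<in> T"
    then obtain W where W: "W \<in> \<V>" "y \<in> W" using \<V>(3) sp unfolding T_def by auto
    then show "y \<in> U" using y N[of W] unfolding T_def by (cases "W = U") auto
  qed
  ultimately show "\<exists>T. openin t2 T \<and> x \<in> T \<and> T \<subseteq> U" by blast
qed

text \<open>The separation axiom is imposed on ordered pairs of points, so it also holds with the two
  topologies exchanged; this forces them to coincide.\<close>

lemma pairwise_boolean_imp_eq:
  assumes "pairwise_boolean t1 t2"
  shows "t1 = t2"
proof -
  have sp: "topspace t1 = topspace t2" and H: "pairwise_hausdorff t1 t2"
    and cp: "pairwise_compact t1 t2"
    using assms by (auto simp: pairwise_boolean_def)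
  have cp': "pairwise_compact t2 t1"
    using cp sp unfolding pairwise_compact_def by (simp add: disj_commute)
  have "openin t2 U" if "openin t1 U" for U
    by (rule pairwise_hausdorff_compact_finer[OF sp cp _ that])
       (use H in \<open>auto simp: pairwise_hausdorff_def\<close>)
  moreover have "openin t1 U" if "openin t2 U" for U
    by (rule pairwise_hausdorff_compact_finer[OF sp[symmetric] cp' _ that])
       (use H sp in \<open>auto simp: pairwise_hausdorff_def, metis Int_commute\<close>)
  ultimately show ?thesis unfolding topology_eq by blast
qed

definition stone_space :: "'b topology \<Rightarrow> bool" where
  "stone_space t \<longleftrightarrow> compact_space t \<and> Hausdorff_space t \<and>
     (\<forall>U x. openin t U \<and> x \<in> U \<longrightarrow> (\<exists>V. openin t V \<and> closedin t V \<and> x \<in> V \<and> V \<subseteq> U))"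

text \<open>For a single topology the pairwise axioms turn into the ordinary ones; the rest is
  \<open>pairwise_boolean_imp_eq\<close>. From here on the work is with one Stone topology.\<close>

lemma pairwise_boolean_iff: "pairwise_boolean t1 t2 \<longleftrightarrow> t1 = t2 \<and> stone_space t1"
proof -
  have "pairwise_boolean t t \<longleftrightarrow> stone_space t" for t :: "'a topology"
    unfolding pairwise_boolean_def pairwise_hausdorff_def pairwise_compact_def
      pairwise_zero_dim_def stone_space_def compact_space_alt Hausdorff_space_def disjnt_def
    by (simp add: conj_ac) blast
  then show ?thesis using pairwise_boolean_imp_eq by blast
qed

section \<open>Ultrafilters and homomorphisms into \<open>L\<close>\<close>

text \<open>The one-element lattice is excluded: over it all maps from a space into L coincide, so
  \<open>zeta\<close> would identify all points of that space.\<close>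

locale vl_algebra =
  fixes A :: "('l::finite_distrib_lattice, 'a) vl_struct"
  assumes nontriv: "(bot::'l) \<noteq> top" and vl: "vl_alg A"
begin

lemma heyting: "heyting_alg A"
  using vl by (simp add: vl_alg_def)

lemma closed [simp, intro]:
  "vzero A \<in> vcarrier A" "vone A \<in> vcarrier A"
  "x \<in> vcarrier A \<Longrightarrow> y \<in> vcarrier A \<Longrightarrow> vmeet A x y \<in> vcarrier A"
  "x \<in> vcarrier A \<Longrightarrow> y \<in> vcarrier A \<Longrightarrow> vjoin A x y \<in> vcarrier A"
  "x \<in> vcarrier A \<Longrightarrow> y \<in> vcarrier A \<Longrightarrow> vimp A x y \<in> vcarrier A"
  "x \<in> vcarrier A \<Longrightarrow> vT A l x \<in> vcarrier A"
proof -
  show "vzero A \<in> vcarrier A" "vone A \<in> vcarrier A"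
    using heyting unfolding heyting_alg_def by blast+
  show "x \<in> vcarrier A \<Longrightarrow> vT A l x \<in> vcarrier A"
    using vl by (simp add: vl_alg_def)
  assume "x \<in> vcarrier A" "y \<in> vcarrier A"
  then show "vmeet A x y \<in> vcarrier A" "vjoin A x y \<in> vcarrier A" "vimp A x y \<in> vcarrier A"
    using heyting unfolding heyting_alg_def by blast+
qed

lemma T_const:
  "vT A bot (vzero A) = vone A" "vT A top (vone A) = vone A"
  using vl by (simp_all add: vl_alg_def)

lemma T_partition:
  assumes "a \<in> vcarrier A"
  shows "vBigJoin A (\<lambda>l. vT A l a) = vone A"
    "vjoin A (vT A l a) (vimp A (vT A l a) (vzero A)) = vone A"
    "l \<noteq> l' \<Longrightarrow> vmeet A (vT A l a) (vT A l' a) = vzero A"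
  using vl assms by (simp_all add: vl_alg_def)

lemma T_extensional:
  assumes "a \<in> vcarrier A" "b \<in> vcarrier A"
  shows "vle A (vBigMeet A (\<lambda>l. viff A (vT A l a) (vT A l b))) (viff A a b)"
  using vl assms by (simp add: vl_alg_def)

section \<open>Order calculus in the Heyting reduct\<close>

lemma meet_comm: "x \<in> vcarrier A \<Longrightarrow> y \<in> vcarrier A \<Longrightarrow> vmeet A x y = vmeet A y x"
  using heyting unfolding heyting_alg_def by blast

lemma join_comm: "x \<in> vcarrier A \<Longrightarrow> y \<in> vcarrier A \<Longrightarrow> vjoin A x y = vjoin A y x"
  using heyting unfolding heyting_alg_def by blast

lemma absorb:
  assumes "x \<in> vcarrier A" "y \<in> vcarrier A"
  shows "vmeet A x (vjoin A x y) = x" "vjoin A x (vmeet A x y) = x"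
  using heyting assms unfolding heyting_alg_def by blast+

lemma assoc:
  assumes "x \<in> vcarrier A" "y \<in> vcarrier A" "z \<in> vcarrier A"
  shows "vmeet A x (vmeet A y z) = vmeet A (vmeet A x y) z"
    "vjoin A x (vjoin A y z) = vjoin A (vjoin A x y) z"
  using heyting assms unfolding heyting_alg_def by blast+

lemma zero_le: "x \<in> vcarrier A \<Longrightarrow> vle A (vzero A) x"
  using heyting unfolding heyting_alg_def vle_def by blast

lemma one_meet: "x \<in> vcarrier A \<Longrightarrow> vmeet A (vone A) x = x"
  using heyting unfolding heyting_alg_def by blast

lemma residuation:
  assumes "x \<in> vcarrier A" "y \<in> vcarrier A" "z \<in> vcarrier A"
  shows "vle A (vmeet A z x) y \<longleftrightarrow> vle A z (vimp A x y)"
  using heyting assms unfolding heyting_alg_def by blast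

lemma meet_idem: "x \<in> vcarrier A \<Longrightarrow> vmeet A x x = x"
  by (metis absorb closed(3))

lemma le_refl: "x \<in> vcarrier A \<Longrightarrow> vle A x x"
  by (simp add: vle_def meet_idem)

lemma le_antisym:
  "x \<in> vcarrier A \<Longrightarrow> y \<in> vcarrier A \<Longrightarrow> vle A x y \<Longrightarrow> vle A y x \<Longrightarrow> x = y"
  unfolding vle_def by (metis meet_comm)

lemma le_trans:
  "x \<in> vcarrier A \<Longrightarrow> y \<in> vcarrier A \<Longrightarrow> z \<in> vcarrier A \<Longrightarrow>
    vle A x y \<Longrightarrow> vle A y z \<Longrightarrow> vle A x z"
  unfolding vle_def by (metis assoc(1))

lemma meet_le1: "x \<in> vcarrier A \<Longrightarrow> y \<in> vcarrier A \<Longrightarrow> vle A (vmeet A x y) x"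
  unfolding vle_def by (metis assoc(1) closed(3) meet_comm meet_idem)

lemma meet_le2: "x \<in> vcarrier A \<Longrightarrow> y \<in> vcarrier A \<Longrightarrow> vle A (vmeet A x y) y"
  by (metis meet_comm meet_le1)

lemma le_meetI:
  "x \<in> vcarrier A \<Longrightarrow> y \<in> vcarrier A \<Longrightarrow> z \<in> vcarrier A \<Longrightarrow>
    vle A z x \<Longrightarrow> vle A z y \<Longrightarrow> vle A z (vmeet A x y)"
  unfolding vle_def by (metis assoc(1))

lemma join_ge1: "x \<in> vcarrier A \<Longrightarrow> y \<in> vcarrier A \<Longrightarrow> vle A x (vjoin A x y)"
  unfolding vle_def by (rule absorb)

lemma join_absorb_le:
  "x \<in> vcarrier A \<Longrightarrow> y \<in> vcarrier A \<Longrightarrow> vle A x y \<Longrightarrow> vjoin A x y = y"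
  unfolding vle_def by (metis absorb(2) join_comm meet_comm)

lemma join_leI:
  assumes "x \<in> vcarrier A" "y \<in> vcarrier A" "z \<in> vcarrier A" "vle A x z" "vle A y z"
  shows "vle A (vjoin A x y) z"
proof -
  have "vjoin A (vjoin A x y) z = z"
    using assms by (metis assoc(2) join_absorb_le)
  then show ?thesis using assms join_ge1 by (metis closed(4))
qed

lemma one_ge: "x \<in> vcarrier A \<Longrightarrow> vle A x (vone A)"
  unfolding vle_def by (metis closed(2) meet_comm one_meet)

lemma le_zero: "x \<in> vcarrier A \<Longrightarrow> vle A x (vzero A) \<Longrightarrow> x = vzero A"
  by (simp add: le_antisym zero_le)

lemma one_le_imp_iff:
  "x \<in> vcarrier A \<Longrightarrow> y \<in> vcarrier A \<Longrightarrow> vle A (vone A) (vimp A x y) \<longleftrightarrow> vle A x y"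
  using residuation[of x y "vone A"] by (simp add: one_meet)

lemma meet_neg: "x \<in> vcarrier A \<Longrightarrow> vmeet A (vimp A x (vzero A)) x = vzero A"
  by (simp add: le_refl le_zero residuation)

section \<open>Filters, ultrafilters and separation by homomorphisms\<close>

definition vfilter :: "'a set \<Rightarrow> bool" where
  "vfilter P \<longleftrightarrow> P \<subseteq> vcarrier A \<and> vone A \<in> P \<and> (\<forall>x\<in>P. \<forall>y\<in>P. vmeet A x y \<in> P) \<and>
     (\<forall>x\<in>P. \<forall>y\<in>vcarrier A. vle A x y \<longrightarrow> y \<in> P)"

text \<open>In a Heyting algebra these are exactly the maximal proper filters, expressed without
  reference to other filters.\<close>

definition ultra :: "'a set \<Rightarrow> bool" where
  "ultra P \<longleftrightarrow> vfilter P \<and> vzero A \<notin> P \<and> (\<forall>x\<in>vcarrier A. x \<in> P \<or> vimp A x (vzero A) \<in> P)"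

lemma vfilter_up: "vfilter P \<Longrightarrow> x \<in> P \<Longrightarrow> y \<in> vcarrier A \<Longrightarrow> vle A x y \<Longrightarrow> y \<in> P"
  unfolding vfilter_def by blast

text \<open>This is the filter generated by \<open>P\<close> and \<open>x\<close>; it supplies the
  proper extension that contradicts maximality in \<open>ex_ultra\<close>.\<close>

lemma vfilter_adjoin:
  assumes P: "vfilter P" and x: "x \<in> vcarrier A"
  shows "vfilter {y \<in> vcarrier A. \<exists>p\<in>P. vle A (vmeet A p x) y}" (is "vfilter ?Q")
  unfolding vfilter_def
proof (intro conjI ballI impI)
  have Pc: "P \<subseteq> vcarrier A" "vone A \<in> P" using P by (auto simp: vfilter_def)
  show "?Q \<subseteq> vcarrier A" by blast
  show "vone A \<in> ?Q" using Pc x one_ge closed by blast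
  show "vmeet A y z \<in> ?Q" if y: "y \<in> ?Q" and z: "z \<in> ?Q" for y z
  proof -
    obtain p q where pq: "p \<in> P" "q \<in> P" "vle A (vmeet A p x) y" "vle A (vmeet A q x) z"
      using y z by blast
    \<comment> \<open>\<open>r\<close> is in \<open>P\<close> and serves as a common witness for
      \<open>y\<close> and \<open>z\<close>, because its meet with \<open>x\<close> is below both
      earlier bounds.\<close>
    define r where "r = vmeet A p q"
    have c: "p \<in> vcarrier A" "q \<in> vcarrier A" "y \<in> vcarrier A" "z \<in> vcarrier A" "r \<in> vcarrier A"
      using pq y z Pc by (auto simp: r_def)
    have rx: "vmeet A r x \<in> vcarrier A" "vmeet A p x \<in> vcarrier A" "vmeet A q x \<in> vcarrier A"
      using c x by auto
    have rp: "vle A (vmeet A r x) p"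
      using le_trans[OF rx(1) c(5) c(1)] meet_le1 c x r_def by metis
    have rq: "vle A (vmeet A r x) q"
      using le_trans[OF rx(1) c(5) c(2)] meet_le1 meet_le2 c x r_def by metis
    have "vle A (vmeet A r x) (vmeet A p x)" "vle A (vmeet A r x) (vmeet A q x)"
      using le_meetI rp rq c x rx meet_le2 by metis+
    then have "vle A (vmeet A r x) y" "vle A (vmeet A r x) z"
      using le_trans rx c pq by metis+
    then have "vle A (vmeet A r x) (vmeet A y z)"
      using le_meetI c rx by metis
    moreover have "r \<in> P" using P pq by (auto simp: vfilter_def r_def)
    ultimately show ?thesis using c by blast
  qed
  show "z \<in> ?Q" if y: "y \<in> ?Q" and z: "z \<in> vcarrier A" "vle A y z" for y z
  proof -
    obtain p where p: "p \<in> P" "vle A (vmeet A p x) y" "y \<in> vcarrier A" using y by blast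
    then have "vle A (vmeet A p x) z"
      using le_trans[of "vmeet A p x" y z] z Pc x by blast
    then show ?thesis using p z by blast
  qed
qed

text \<open>Zorn's lemma applies to the proper filters containing \<open>e\<close>, among them the
  principal filter of \<open>e\<close>. A maximal one is then shown to decide every element.\<close>

lemma ex_ultra:
  assumes e: "e \<in> vcarrier A" "e \<noteq> vzero A"
  shows "\<exists>P. ultra P \<and> e \<in> P"
proof -
  define \<F> where "\<F> = {P. vfilter P \<and> vzero A \<notin> P \<and> e \<in> P}"
  have "{y \<in> vcarrier A. vle A e y} \<in> \<F>"
  proof -
    have "vfilter {y \<in> vcarrier A. vle A e y}"
      unfolding vfilter_def
    proof (intro conjI ballI impI)
      show "vone A \<in> {y \<in> vcarrier A. vle A e y}" using one_ge[OF e(1)] by simp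
      show "vmeet A x y \<in> {y \<in> vcarrier A. vle A e y}"
        if "x \<in> {y \<in> vcarrier A. vle A e y}" "y \<in> {y \<in> vcarrier A. vle A e y}" for x y
        using that le_meetI[of x y e] e by simp
      show "y \<in> {y \<in> vcarrier A. vle A e y}"
        if "x \<in> {y \<in> vcarrier A. vle A e y}" "y \<in> vcarrier A" "vle A x y" for x y
        using that le_trans[of e x y] e by simp
    qed simp
    then show ?thesis
      unfolding \<F>_def using e le_zero[OF e(1)] le_refl[OF e(1)] by auto
  qed
  then have ne: "\<F> \<noteq> {}" by blast
  have "\<Union>\<C> \<in> \<F>" if C: "\<C> \<noteq> {}" "subset.chain \<F> \<C>" for \<C>
  proof -
    have sub: "\<C> \<subseteq> \<F>" and ch: "\<And>P Q. P \<in> \<C> \<Longrightarrow> Q \<in> \<C> \<Longrightarrow> P \<subseteq> Q \<or> Q \<subseteq> P"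
      using C(2) by (auto simp: subset_chain_def)
    then have F: "\<And>P. P \<in> \<C> \<Longrightarrow> vfilter P \<and> vzero A \<notin> P \<and> e \<in> P"
      by (auto simp: \<F>_def)
    have "vmeet A x y \<in> \<Union>\<C>" if xy: "x \<in> \<Union>\<C>" "y \<in> \<Union>\<C>" for x y
    proof -
      obtain P Q where PQ: "P \<in> \<C>" "Q \<in> \<C>" "x \<in> P" "y \<in> Q" using xy by blast
      then obtain R where "R \<in> \<C>" "x \<in> R" "y \<in> R" using ch by blast
      then show ?thesis using F[of R] unfolding vfilter_def by blast
    qed
    moreover have "y \<in> \<Union>\<C>" if "x \<in> \<Union>\<C>" "y \<in> vcarrier A" "vle A x y" for x y
      using that F unfolding vfilter_def by blast
    moreover have "\<Union>\<C> \<subseteq> vcarrier A" "vone A \<in> \<Union>\<C>"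
      using F C(1) unfolding vfilter_def by blast+
    ultimately have "vfilter (\<Union>\<C>)" unfolding vfilter_def by blast
    then show ?thesis using F C(1) unfolding \<F>_def by blast
  qed
  then obtain M where M: "M \<in> \<F>" and max: "\<And>X. X \<in> \<F> \<Longrightarrow> M \<subseteq> X \<Longrightarrow> X = M"
    using subset_Zorn_nonempty[OF ne] by blast
  have MF: "vfilter M" "vzero A \<notin> M" "e \<in> M" and Mc: "M \<subseteq> vcarrier A" "vone A \<in> M"
    using M by (auto simp: \<F>_def vfilter_def)
  \<comment> \<open>If \<open>x\<close> is not in \<open>M\<close>, the filter generated by
    \<open>M\<close> and \<open>x\<close> is strictly larger and so contains 0. Hence some
    \<open>p\<close> in \<open>M\<close> has meet 0 with \<open>x\<close>, that is, \<open>p\<close>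
    lies below the negation of \<open>x\<close>.\<close>
  have "vimp A x (vzero A) \<in> M" if x: "x \<in> vcarrier A" "x \<notin> M" for x
  proof -
    define Q where "Q = {y \<in> vcarrier A. \<exists>p\<in>M. vle A (vmeet A p x) y}"
    have "vfilter Q" unfolding Q_def using vfilter_adjoin MF x by blast
    moreover have MQ: "M \<subseteq> Q" unfolding Q_def using Mc x meet_le1 by blast
    moreover have "x \<in> Q" unfolding Q_def using Mc x meet_le2 by blast
    ultimately have "vzero A \<in> Q"
      using max[of Q] x MF unfolding \<F>_def by blast
    then obtain p where p: "p \<in> M" "vle A (vmeet A p x) (vzero A)"
      unfolding Q_def by blast
    then have "vle A p (vimp A x (vzero A))"
      using residuation x Mc by blast
    then show ?thesis using vfilter_up[OF MF(1) p(1)] x by blast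
  qed
  then show ?thesis using MF unfolding ultra_def by blast
qed

text \<open>Ultrafilters are prime: otherwise the meet \<open>p\<close> of the two negations is in
  \<open>P\<close>, although its meet with the join of \<open>x\<close> and \<open>y\<close> is
  0.\<close>

lemma ultra_join:
  assumes P: "ultra P" and x: "x \<in> vcarrier A" and y: "y \<in> vcarrier A" and j: "vjoin A x y \<in> P"
  shows "x \<in> P \<or> y \<in> P"
proof (rule ccontr)
  assume "\<not> ?thesis"
  then have n: "vimp A x (vzero A) \<in> P" "vimp A y (vzero A) \<in> P"
    using P x y unfolding ultra_def by blast+
  define p where "p = vmeet A (vimp A x (vzero A)) (vimp A y (vzero A))"
  have pP: "p \<in> P" using n P unfolding ultra_def vfilter_def p_def by blast
  have pc: "p \<in> vcarrier A" using x y by (simp add: p_def)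
  have "vle A p (vimp A x (vzero A))" "vle A p (vimp A y (vzero A))"
    unfolding p_def using x y by (simp_all add: meet_le1 meet_le2)
  then have "vle A (vmeet A p x) (vzero A)" "vle A (vmeet A p y) (vzero A)"
    using residuation x y pc by auto
  \<comment> \<open>Residuation with the roles exchanged turns disjointness from \<open>p\<close>
    into an upper bound for \<open>x\<close> and \<open>y\<close>, hence for their join. This
    replaces an appeal to the distributive law.\<close>
  then have "vle A x (vimp A p (vzero A))" "vle A y (vimp A p (vzero A))"
    using residuation x y pc meet_comm by (metis closed(1))+
  then have "vle A (vjoin A x y) (vimp A p (vzero A))"
    using join_leI x y pc by auto
  then have "vmeet A (vjoin A x y) p = vzero A"
    using residuation x y pc le_zero by auto
  then show False using P j pP unfolding ultra_def vfilter_def by force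
qed

lemma ultra_foldr_join:
  assumes P: "ultra P" and f: "\<And>l. f l \<in> vcarrier A"
  shows "foldr (vjoin A) (map f xs) (vzero A) \<in> P \<Longrightarrow> \<exists>l. f l \<in> P"
proof (induction xs)
  case Nil
  then show ?case using P by (simp add: ultra_def)
next
  case (Cons x xs)
  have "foldr (vjoin A) (map f xs) (vzero A) \<in> vcarrier A"
    by (induction xs) (use f in auto)
  then show ?case using Cons ultra_join[OF P f[of x]] by auto
qed

lemma T_op:
  assumes "a \<in> vcarrier A" "b \<in> vcarrier A"
  shows "vle A (vmeet A (vT A p a) (vT A q b)) (vT A (himpL p q) (vimp A a b))"
    "vle A (vmeet A (vT A p a) (vT A q b)) (vT A (inf p q) (vmeet A a b))"
    "vle A (vmeet A (vT A p a) (vT A q b)) (vT A (sup p q) (vjoin A a b))"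
    "vle A (vT A q a) (vT A (TL p q) (vT A p a))"
proof -
  let ?x = "vmeet A (vT A p a) (vT A q b)"
  let ?i = "vT A (himpL p q) (vimp A a b)" and ?m = "vT A (inf p q) (vmeet A a b)"
    and ?j = "vT A (sup p q) (vjoin A a b)"
  have c: "?x \<in> vcarrier A" "?i \<in> vcarrier A" "?m \<in> vcarrier A" "?j \<in> vcarrier A"
    "vmeet A ?m ?j \<in> vcarrier A" "vmeet A ?i (vmeet A ?m ?j) \<in> vcarrier A"
    using assms by auto
  have le: "vle A ?x (vmeet A ?i (vmeet A ?m ?j))" and T: "vle A (vT A q a) (vT A (TL p q) (vT A p a))"
    using vl assms by (simp_all add: vl_alg_def)
  show "vle A ?x ?i" using le_trans[OF c(1) c(6) c(2) le] meet_le1 c by blast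
  have "vle A ?x (vmeet A ?m ?j)" using le_trans[OF c(1) c(6) c(5) le] meet_le2 c by blast
  note mj = le_trans[OF c(1) c(5) _ this]
  show "vle A ?x ?m" using mj c meet_le1 by blast
  show "vle A ?x ?j" using mj c meet_le2 by blast
  show "vle A (vT A q a) (vT A (TL p q) (vT A p a))" by (fact T)
qed

text \<open>An ultrafilter contains exactly one of the elements \<open>T_l a\<close>; reading off this \<open>l\<close> is a
  homomorphism into \<open>L\<close> by axioms (ii) and (iii).\<close>

lemma ultra_hom:
  assumes P: "ultra P"
  shows "\<exists>v\<in>vhom A L_alg. \<forall>a\<in>vcarrier A. \<forall>l. v a = l \<longleftrightarrow> vT A l a \<in> P"
proof -
  have F: "vfilter P" "vzero A \<notin> P" "vone A \<in> P" using P by (auto simp: ultra_def vfilter_def)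
  have mP: "vmeet A x y \<in> P" if "x \<in> P" "y \<in> P" for x y
    using F that by (auto simp: vfilter_def)
  \<comment> \<open>Axiom (iv) gives both halves of unique existence: the join of all
    \<open>vT A l a\<close> is 1, so primality puts one of them in \<open>P\<close>, and two
    different ones have meet 0.\<close>
  have ex: "\<exists>l. vT A l a \<in> P" if a: "a \<in> vcarrier A" for a
  proof -
    show ?thesis
      using T_partition(1)[OF a] ultra_foldr_join[OF P, of "\<lambda>l. vT A l a" lvals] a F unfolding vBigJoin_def by auto
  qed
  have uniq: "l1 = l2" if "a \<in> vcarrier A" "vT A l1 a \<in> P" "vT A l2 a \<in> P" for a l1 l2
  proof (rule ccontr)
    assume "l1 \<noteq> l2"
    then have "vmeet A (vT A l1 a) (vT A l2 a) = vzero A"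
      using T_partition(3) that by blast
    then show False using mP[OF that(2,3)] F by simp
  qed
  define v where "v = (\<lambda>a\<in>vcarrier A. THE l. vT A l a \<in> P)"
  have v: "v a = l \<longleftrightarrow> vT A l a \<in> P" if "a \<in> vcarrier A" for a l
  proof -
    have "\<exists>!l. vT A l a \<in> P" using ex uniq that by blast
    then show ?thesis using that unfolding v_def by (auto intro: the_equality theI')
  qed
  have up: "y \<in> P" if "x \<in> P" "vle A x y" "y \<in> vcarrier A" for x y
    using vfilter_up F that by blast
  have tv: "vT A (v a) a \<in> P" if "a \<in> vcarrier A" for a using v that by blast
  have op: "v (vmeet A a b) = inf (v a) (v b)" "v (vjoin A a b) = sup (v a) (v b)"
      "v (vimp A a b) = himpL (v a) (v b)" if ab: "a \<in> vcarrier A" "b \<in> vcarrier A" for a b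
  proof -
    have m: "vmeet A (vT A (v a) a) (vT A (v b) b) \<in> P" using mP tv ab by blast
    show "v (vmeet A a b) = inf (v a) (v b)" "v (vjoin A a b) = sup (v a) (v b)"
      "v (vimp A a b) = himpL (v a) (v b)"
      using up[OF m] T_op(1-3)[OF ab] ab v by auto
  qed
  have T: "v (vT A l a) = TL l (v a)" if "a \<in> vcarrier A" for l a
    using up[OF tv[OF that]] T_op(4)[OF that that] that v by auto
  have "v (vzero A) = bot" "v (vone A) = top" using v F T_const by auto
  moreover have "v \<in> extensional (vcarrier A)" by (simp add: v_def)
  ultimately have "v \<in> vhom A L_alg"
    using op T by (simp add: vhom_def L_alg_def PiE_def)
  then show ?thesis using v by blast
qed

lemma foldr_meet_one:
  "(\<And>l. f l = vone A) \<Longrightarrow> foldr (vmeet A) (map f xs) (vone A) = vone A"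
  by (induction xs) (auto simp: one_meet)

text \<open>The failing inequality makes the meet \<open>?e\<close> of \<open>vT A l a\<close> with
  the negation of \<open>vT A l b\<close> nonzero. An ultrafilter containing \<open>?e\<close>
  yields a \<open>v\<close> with \<open>v a = l\<close> and \<open>v b \<noteq> l\<close>.\<close>

lemma hom_separates_T:
  assumes a: "a \<in> vcarrier A" and b: "b \<in> vcarrier A" and nle: "\<not> vle A (vT A l a) (vT A l b)"
  shows "\<exists>v\<in>vhom A L_alg. v a \<noteq> v b"
proof -
  let ?n = "vimp A (vT A l b) (vzero A)"
  let ?e = "vmeet A (vT A l a) ?n"
  have c: "?n \<in> vcarrier A" "vT A l a \<in> vcarrier A" "vT A l b \<in> vcarrier A" "?e \<in> vcarrier A"
    using a b by auto
  have "?e \<noteq> vzero A"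
  proof
    assume "?e = vzero A"
    \<comment> \<open>The implication from \<open>vT A l a\<close> to \<open>vT A l b\<close> will
      lie above both \<open>vT A l b\<close> and its negation. By axiom (iv) their join is 1, which
      forces the excluded inequality.\<close>
    then have "vle A (vmeet A ?n (vT A l a)) (vT A l b)"
      using meet_comm[OF c(1,2)] zero_le c by simp
    then have 1: "vle A ?n (vimp A (vT A l a) (vT A l b))" using residuation c by blast
    have 2: "vle A (vT A l b) (vimp A (vT A l a) (vT A l b))"
      using residuation[OF c(2) c(3) c(3)] meet_le1[OF c(3,2)] by blast
    have "vle A (vone A) (vimp A (vT A l a) (vT A l b))"
      using join_leI[OF c(3) c(1) _ 2 1] c T_partition(2)[OF b, of l] by auto
    then show False using nle one_le_imp_iff c by blast
  qed
  then obtain P where P: "ultra P" "?e \<in> P" using ex_ultra c by blast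
  then have F: "vfilter P" "vzero A \<notin> P" by (auto simp: ultra_def)
  have n: "vT A l a \<in> P" "?n \<in> P"
    using vfilter_up[OF F(1) P(2)] meet_le1[OF c(2,1)] meet_le2[OF c(2,1)] c by blast+
  then have "vT A l b \<notin> P"
    using F meet_neg[OF c(3)] unfolding vfilter_def by force
  moreover obtain v where v: "v \<in> vhom A L_alg" "\<forall>a\<in>vcarrier A. \<forall>l. v a = l \<longleftrightarrow> vT A l a \<in> P"
    using ultra_hom[OF P(1)] by blast
  ultimately have "v a = l" "v b \<noteq> l" using a b n by blast+
  then show ?thesis using v(1) by metis
qed

text \<open>If all \<open>vT A l a\<close> and \<open>vT A l b\<close> agreed, the big meet in axiom
  (vii) would be 1 and \<open>a = b\<close>. So they differ for some \<open>l\<close>, and then one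
  of the two inequalities fails.\<close>

lemma hom_separates:
  assumes a: "a \<in> vcarrier A" and b: "b \<in> vcarrier A" and ne: "a \<noteq> b"
  shows "\<exists>v\<in>vhom A L_alg. v a \<noteq> v b"
proof -
  have "\<exists>l. vT A l a \<noteq> vT A l b"
  proof (rule ccontr)
    assume "\<not> ?thesis"
    then have eq: "vT A l a = vT A l b" for l by blast
    have "vimp A x x = vone A" if "x \<in> vcarrier A" for x
      using one_le_imp_iff[OF that that] le_refl[OF that] le_antisym one_ge that by auto
    then have "viff A (vT A l a) (vT A l b) = vone A" for l
      unfolding viff_def using eq b by (simp add: one_meet)
    then have "vBigMeet A (\<lambda>l. viff A (vT A l a) (vT A l b)) = vone A"
      unfolding vBigMeet_def by (rule foldr_meet_one)
    then have le: "vle A (vone A) (viff A a b)"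
      using T_extensional[OF a b] by simp
    have c: "vimp A a b \<in> vcarrier A" "vimp A b a \<in> vcarrier A" using a b by auto
    have "vle A (vone A) (vimp A a b)" "vle A (vone A) (vimp A b a)"
      using le_trans[OF _ _ _ le[unfolded viff_def]] c meet_le1[OF c] meet_le2[OF c] by auto
    then have "vle A a b" "vle A b a" using one_le_imp_iff a b by auto
    then show False using ne le_antisym a b by blast
  qed
  then obtain l where "vT A l a \<noteq> vT A l b" by blast
  then have "\<not> vle A (vT A l a) (vT A l b) \<or> \<not> vle A (vT A l b) (vT A l a)"
    using le_antisym a b by blast
  then show ?thesis using hom_separates_T[OF a b] hom_separates_T[OF b a] by metis
qed

end

section \<open>The dual space of an algebra\<close>

lemma L_alg_simps [simp]:
  "vcarrier L_alg = UNIV" "vmeet L_alg = inf" "vjoin L_alg = sup" "vimp L_alg = himpL"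
  "vT L_alg = TL" "vzero L_alg = bot" "vone L_alg = top"
  by (simp_all add: L_alg_def)

lemma L_pbs_simps [simp]:
  "ptop1 L_pbs = discrete_topology UNIV" "ptop2 L_pbs = discrete_topology UNIV" "palpha L_pbs = id"
  by (simp_all add: L_pbs_def)

lemma Fobj_simps [simp]:
  "vcarrier (Fobj B) = pbs_hom B L_pbs"
  "vmeet (Fobj B) = (\<lambda>f g. \<lambda>s\<in>pspace B. inf (f s) (g s))"
  "vjoin (Fobj B) = (\<lambda>f g. \<lambda>s\<in>pspace B. sup (f s) (g s))"
  "vimp (Fobj B) = (\<lambda>f g. \<lambda>s\<in>pspace B. himpL (f s) (g s))"
  "vT (Fobj B) = (\<lambda>p f. \<lambda>s\<in>pspace B. TL p (f s))"
  "vzero (Fobj B) = (\<lambda>s\<in>pspace B. bot)"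
  "vone (Fobj B) = (\<lambda>s\<in>pspace B. top)"
  by (simp_all add: Fobj_def)

lemma vhomD:
  assumes "f \<in> vhom A B"
  shows "f \<in> extensional (vcarrier A)"
    "x \<in> vcarrier A \<Longrightarrow> f x \<in> vcarrier B"
    "x \<in> vcarrier A \<Longrightarrow> y \<in> vcarrier A \<Longrightarrow> f (vmeet A x y) = vmeet B (f x) (f y)"
    "x \<in> vcarrier A \<Longrightarrow> y \<in> vcarrier A \<Longrightarrow> f (vjoin A x y) = vjoin B (f x) (f y)"
    "x \<in> vcarrier A \<Longrightarrow> y \<in> vcarrier A \<Longrightarrow> f (vimp A x y) = vimp B (f x) (f y)"
    "x \<in> vcarrier A \<Longrightarrow> f (vT A l x) = vT B l (f x)"
    "f (vzero A) = vzero B" "f (vone A) = vone B"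
  using assms by (auto simp: vhom_def PiE_iff)

lemma vhom_LD:
  assumes "v \<in> vhom A L_alg"
  shows "x \<in> vcarrier A \<Longrightarrow> y \<in> vcarrier A \<Longrightarrow> v (vmeet A x y) = inf (v x) (v y)"
    "x \<in> vcarrier A \<Longrightarrow> y \<in> vcarrier A \<Longrightarrow> v (vjoin A x y) = sup (v x) (v y)"
    "x \<in> vcarrier A \<Longrightarrow> y \<in> vcarrier A \<Longrightarrow> v (vimp A x y) = himpL (v x) (v y)"
    "x \<in> vcarrier A \<Longrightarrow> v (vT A l x) = TL l (v x)"
    "v (vzero A) = bot" "v (vone A) = top"
  using vhomD(3-)[OF assms] by simp_all

context vl_algebra
begin

lemma TL_eq_top_iff: "TL l x = top \<longleftrightarrow> x = (l::'l)"
  using nontriv by (auto simp: TL_def)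

text \<open>Homomorphisms commute with the operations T, so the fibres of evaluation at
  \<open>a\<close> are themselves basic open sets.\<close>

lemma basic_open_T:
  "a \<in> vcarrier A \<Longrightarrow> basic_open A (vT A l a) = {v \<in> vhom A L_alg. v a = l}"
  by (auto simp: basic_open_def vhom_LD TL_eq_top_iff)

text \<open>The value of \<open>vT A top a\<close> under \<open>v\<close> is always 0 or 1, so
  negating it gives the complement. Negating \<open>a\<close> itself would miss those
  \<open>v\<close> with \<open>v a\<close> strictly between 0 and 1.\<close>

lemma basic_open_neg:
  assumes "a \<in> vcarrier A"
  shows "basic_open A (vimp A (vT A top a) (vzero A)) = vhom A L_alg - basic_open A a"
  using assms nontriv by (auto simp: basic_open_def vhom_LD himpL_eq_top_iff TL_def bot_unique)

lemma basic_open_meet: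
  "a \<in> vcarrier A \<Longrightarrow> b \<in> vcarrier A \<Longrightarrow> basic_open A (vmeet A a b) = basic_open A a \<inter> basic_open A b"
  by (auto simp: basic_open_def vhom_LD)

lemma ptop2_Gobj: "ptop2 (Gobj A) = ptop1 (Gobj A)"
proof -
  have "(\<lambda>a. vhom A L_alg - basic_open A a) ` vcarrier A = basic_open A ` vcarrier A"
  proof (intro equalityI subsetI)
    fix U assume "U \<in> (\<lambda>a. vhom A L_alg - basic_open A a) ` vcarrier A"
    then show "U \<in> basic_open A ` vcarrier A"
      using basic_open_neg by fastforce
  next
    fix U assume "U \<in> basic_open A ` vcarrier A"
    then obtain a where a: "a \<in> vcarrier A" "U = basic_open A a" by blast
    then have "U = vhom A L_alg - basic_open A (vimp A (vT A top a) (vzero A))"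
      using basic_open_neg[OF a(1)] by (auto simp: basic_open_def)
    then show "U \<in> (\<lambda>a. vhom A L_alg - basic_open A a) ` vcarrier A"
      using a(1) by blast
  qed
  then show ?thesis by (simp add: Gobj_def)
qed

lemma pspace_Gobj: "pspace (Gobj A) = vhom A L_alg"
proof -
  have "basic_open A (vone A) = vhom A L_alg"
    by (auto simp: basic_open_def vhom_LD)
  moreover have "\<And>a. basic_open A a \<subseteq> vhom A L_alg" by (auto simp: basic_open_def)
  ultimately have "\<Union>(basic_open A ` vcarrier A) = vhom A L_alg"
    using closed(2) by blast
  then show ?thesis by (simp add: Gobj_def)
qed

lemma palpha_Gobj: "palpha (Gobj A) L' = {v \<in> vhom A L_alg. v ` vcarrier A \<subseteq> L'}"
  by (simp add: Gobj_def)

lemma openin_basic: "a \<in> vcarrier A \<Longrightarrow> openin (ptop1 (Gobj A)) (basic_open A a)"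
  by (simp add: Gobj_def topology_generated_by_Basis)

lemma closedin_basic:
  assumes "a \<in> vcarrier A" shows "closedin (ptop1 (Gobj A)) (basic_open A a)"
proof -
  have "pspace (Gobj A) - basic_open A a = basic_open A (vimp A (vT A top a) (vzero A))"
    using basic_open_neg[OF assms] pspace_Gobj by simp
  then show ?thesis
    using assms openin_basic pspace_Gobj by (auto simp: closedin_def basic_open_def)
qed

text \<open>The generating sets are closed under binary intersection by
  \<open>basic_open_meet\<close>, so the subbasis is a basis. The induction follows the generation
  of the topology.\<close>

lemma basic_open_base:
  assumes "openin (ptop1 (Gobj A)) U" "v \<in> U"
  shows "\<exists>b\<in>vcarrier A. v \<in> basic_open A b \<and> basic_open A b \<subseteq> U"
proof -
  have "generate_topology_on (basic_open A ` vcarrier A) U"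
    using assms(1) by (simp add: Gobj_def openin_topology_generated_by_iff)
  then show ?thesis using assms(2)
  proof (induction arbitrary: v rule: generate_topology_on.induct)
    case (Int X Y)
    then obtain b c where bc: "b \<in> vcarrier A" "c \<in> vcarrier A" "v \<in> basic_open A b"
      "v \<in> basic_open A c" "basic_open A b \<subseteq> X" "basic_open A c \<subseteq> Y"
      by (metis IntD1 IntD2)
    then show ?case
      using basic_open_meet[OF bc(1,2)] by (intro bexI[of _ "vmeet A b c"]) auto
  next
    case (UN K)
    then obtain X where X: "X \<in> K" "v \<in> X" by blast
    then show ?case using UN.IH[OF X] by blast
  qed auto
qed

lemma eval_continuous:
  "a \<in> vcarrier A \<Longrightarrow> continuous_map (ptop1 (Gobj A)) (discrete_topology UNIV) (\<lambda>v. v a)"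
  unfolding continuous_map_discrete_iff pspace_Gobj
  by (simp add: basic_open_T[symmetric] openin_basic)

text \<open>By Tychonoff the product \<open>K\<close> of copies of the finite discrete L is compact.
  The homomorphisms form a closed subset of it, and the topology of G(A) is no finer than the one
  induced by \<open>K\<close>.\<close>

lemma compact_Gobj: "compact_space (ptop1 (Gobj A))"
proof -
  define K :: "('a \<Rightarrow> 'l) topology"
    where "K = product_topology (\<lambda>_. discrete_topology UNIV) (vcarrier A)"
  have cK: "compact_space K"
    unfolding K_def by (simp add: compact_space_product_topology compact_space_discrete_topology)
  have tK: "topspace K = (vcarrier A \<rightarrow>\<^sub>E UNIV)" by (simp add: K_def)
  have ev: "continuous_map K (discrete_topology UNIV) (\<lambda>v. v a)" if "a \<in> vcarrier A" for a
    unfolding K_def using continuous_map_product_projection[OF that, of "\<lambda>_. discrete_topology UNIV"] .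
  \<comment> \<open>Every homomorphism condition at fixed arguments has this shape. For the
    constants and for \<open>TL l\<close>, choose an \<open>h\<close> that ignores one or both
    arguments.\<close>
  have c: "closedin K {v \<in> topspace K. v x = h (v y) (v z)}"
    if "x \<in> vcarrier A" "y \<in> vcarrier A" "z \<in> vcarrier A" for x y z h
    using continuous_map_discrete_eq_clopen(2)[OF ev[OF that(1)]
        continuous_map_discrete_binop[OF ev[OF that(2)] ev[OF that(3)]]] .
  define \<C> where "\<C> = insert {v \<in> topspace K. v (vzero A) = bot} (insert {v \<in> topspace K. v (vone A) = top}
     ((\<lambda>(x, y). {v \<in> topspace K. v (vmeet A x y) = inf (v x) (v y)}) ` (vcarrier A \<times> vcarrier A) \<union>
      (\<lambda>(x, y). {v \<in> topspace K. v (vjoin A x y) = sup (v x) (v y)}) ` (vcarrier A \<times> vcarrier A) \<union>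
      (\<lambda>(x, y). {v \<in> topspace K. v (vimp A x y) = himpL (v x) (v y)}) ` (vcarrier A \<times> vcarrier A) \<union>
      (\<lambda>(l, x). {v \<in> topspace K. v (vT A l x) = TL l (v x)}) ` (UNIV \<times> vcarrier A)))"
  have "closedin K C" if "C \<in> \<C>" for C
    using that c[OF closed(1,1,1), of "\<lambda>_ _. bot"] c[OF closed(2,2,2), of "\<lambda>_ _. top"] c[of _ _ _ inf] c[of _ _ _ sup]
      c[of _ _ _ himpL] c[of _ _ _ "\<lambda>x _. TL l x" for l]
    unfolding \<C>_def by auto
  then have "closedin K (\<Inter>\<C>)"
    by (intro closedin_Inter) (auto simp: \<C>_def)
  moreover have "\<Inter>\<C> = vhom A L_alg"
    unfolding \<C>_def vhom_def tK by (auto simp: ball_Un)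
  ultimately have cpt: "compactin K (vhom A L_alg)"
    using cK closedin_compact_space by metis
  \<comment> \<open>Compactness is transported along the identity, from the subspace of
    \<open>K\<close> to G(A).\<close>
  have "continuous_map (subtopology K (vhom A L_alg)) (ptop1 (Gobj A)) (\<lambda>v. v)"
    unfolding Gobj_def pbs.simps
  proof (rule continuous_on_generated_topo)
    fix U assume "U \<in> basic_open A ` vcarrier A"
    then obtain a where a: "a \<in> vcarrier A" "U = basic_open A a" by blast
    then have "(\<lambda>v. v) -` U \<inter> topspace (subtopology K (vhom A L_alg)) =
        {v \<in> topspace K. v a = top} \<inter> vhom A L_alg"
      by (auto simp: basic_open_def)
    then show "openin (subtopology K (vhom A L_alg)) ((\<lambda>v. v) -` U \<inter> topspace (subtopology K (vhom A L_alg)))"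
      using ev[OF a(1)] unfolding continuous_map_discrete_iff
      by (simp add: openin_subtopology_Int)
  next
    show "(\<lambda>v. v) ` topspace (subtopology K (vhom A L_alg)) \<subseteq> \<Union> (basic_open A ` vcarrier A)"
      using pspace_Gobj by (auto simp: Gobj_def)
  qed
  then have "compactin (ptop1 (Gobj A)) ((\<lambda>v. v) ` vhom A L_alg)"
    using image_compactin cpt by (metis compactin_subtopology order_refl)
  then show ?thesis by (simp add: compact_space_def pspace_Gobj)
qed

lemma stone_Gobj: "stone_space (ptop1 (Gobj A))"
  unfolding stone_space_def
proof (intro conjI allI impI)
  show "compact_space (ptop1 (Gobj A))" by (rule compact_Gobj)
  show "Hausdorff_space (ptop1 (Gobj A))"
    unfolding Hausdorff_space_def pspace_Gobj
  proof (intro allI impI)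
    fix v w :: "'a \<Rightarrow> 'l"
    assume vw: "v \<in> vhom A L_alg \<and> w \<in> vhom A L_alg \<and> v \<noteq> w"
    \<comment> \<open>Homomorphisms are extensional, so two different ones already differ at an
      element of the carrier.\<close>
    then obtain a where a: "a \<in> vcarrier A" "v a \<noteq> w a"
      by (metis extensionalityI vhomD(1))
    have "disjnt (basic_open A (vT A (v a) a)) (basic_open A (vT A (w a) a))"
      unfolding basic_open_T[OF a(1)] disjnt_def using a(2) by fastforce
    moreover have "v \<in> basic_open A (vT A (v a) a)" "w \<in> basic_open A (vT A (w a) a)"
      using vw by (simp_all add: basic_open_T[OF a(1)])
    ultimately show "\<exists>U V. openin (ptop1 (Gobj A)) U \<and> openin (ptop1 (Gobj A)) V \<and>
        v \<in> U \<and> w \<in> V \<and> disjnt U V"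
      using openin_basic[OF closed(6)[OF a(1)]] by blast
  qed
  show "\<exists>V. openin (ptop1 (Gobj A)) V \<and> closedin (ptop1 (Gobj A)) V \<and> v \<in> V \<and> V \<subseteq> U"
    if "openin (ptop1 (Gobj A)) U \<and> v \<in> U" for U v
    using basic_open_base[of U v] that openin_basic closedin_basic by blast
qed

lemma pbs_obj_Gobj: "pbs_obj (Gobj A)"
  unfolding pbs_obj_def
proof (intro conjI ballI)
  show "pairwise_boolean (ptop1 (Gobj A)) (ptop2 (Gobj A))"
    by (simp add: pairwise_boolean_iff ptop2_Gobj stone_Gobj)
  show "palpha (Gobj A) UNIV = pspace (Gobj A)"
    by (simp add: palpha_Gobj pspace_Gobj)
  show "palpha (Gobj A) (L2 \<inter> L3) = palpha (Gobj A) L2 \<inter> palpha (Gobj A) L3" for L2 L3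
    by (auto simp: palpha_Gobj)
  fix L' :: "'l set"
  \<comment> \<open>An intersection of preimages of \<open>L'\<close> under the continuous
    evaluations is closed.\<close>
  have "palpha (Gobj A) L' = (\<Inter>a\<in>vcarrier A. {v \<in> topspace (ptop1 (Gobj A)). v a \<in> L'})"
    using closed(1) by (auto simp: palpha_Gobj pspace_Gobj)
  moreover have "closedin (ptop1 (Gobj A)) \<dots>"
  proof (intro closedin_INT)
    show "vcarrier A \<noteq> {}" using closed(1) by blast
    show "closedin (ptop1 (Gobj A)) {v \<in> pspace (Gobj A). v a \<in> L'}" if "a \<in> vcarrier A" for a
      using closedin_continuous_map_preimage[OF eval_continuous[OF that], of L'] by simp
  qed
  ultimately show "pairwise_closed (ptop1 (Gobj A)) (ptop2 (Gobj A)) (palpha (Gobj A) L')"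
    by (simp add: pairwise_closed_def ptop2_Gobj)
qed

section \<open>The evaluation map from an algebra to its double dual\<close>

lemma beta_apply: "a \<in> vcarrier A \<Longrightarrow> beta A a = (\<lambda>v\<in>vhom A L_alg. v a)"
  by (simp add: beta_def)

lemma beta_carrier:
  assumes a: "a \<in> vcarrier A" shows "beta A a \<in> pbs_hom (Gobj A) L_pbs"
proof -
  have "continuous_map (ptop1 (Gobj A)) (discrete_topology UNIV) (\<lambda>v\<in>vhom A L_alg. v a)"
    by (rule continuous_map_eq[OF eval_continuous[OF a]]) (simp add: pspace_Gobj)
  then show ?thesis
    using a by (auto simp: pbs_hom_def beta_apply ptop2_Gobj pspace_Gobj palpha_Gobj)
qed

lemma beta_hom: "beta A \<in> vhom A (Fobj (Gobj A))"
  unfolding vhom_def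
proof (intro CollectI conjI ballI allI)
  show "beta A \<in> vcarrier A \<rightarrow>\<^sub>E vcarrier (Fobj (Gobj A))"
    using beta_carrier by (auto simp: beta_def)
  show "beta A (vzero A) = vzero (Fobj (Gobj A))" "beta A (vone A) = vone (Fobj (Gobj A))"
    unfolding beta_apply[OF closed(1)] beta_apply[OF closed(2)] Fobj_simps pspace_Gobj
    by (auto intro!: restrict_ext dest: vhom_LD(5,6))
  fix a assume a: "a \<in> vcarrier A"
  show "beta A (vT A l a) = vT (Fobj (Gobj A)) l (beta A a)" for l
    unfolding beta_apply[OF closed(6)[OF a]] beta_apply[OF a] Fobj_simps pspace_Gobj
    using vhom_LD(4)[OF _ a] by (auto intro!: restrict_ext)
  fix b assume b: "b \<in> vcarrier A"
  show "beta A (vmeet A a b) = vmeet (Fobj (Gobj A)) (beta A a) (beta A b)"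
    unfolding beta_apply[OF closed(3)[OF a b]] beta_apply[OF a] beta_apply[OF b] Fobj_simps pspace_Gobj
    using vhom_LD(1)[OF _ a b] by (auto intro!: restrict_ext)
  show "beta A (vjoin A a b) = vjoin (Fobj (Gobj A)) (beta A a) (beta A b)"
    unfolding beta_apply[OF closed(4)[OF a b]] beta_apply[OF a] beta_apply[OF b] Fobj_simps pspace_Gobj
    using vhom_LD(2)[OF _ a b] by (auto intro!: restrict_ext)
  show "beta A (vimp A a b) = vimp (Fobj (Gobj A)) (beta A a) (beta A b)"
    unfolding beta_apply[OF closed(5)[OF a b]] beta_apply[OF a] beta_apply[OF b] Fobj_simps pspace_Gobj
    using vhom_LD(3)[OF _ a b] by (auto intro!: restrict_ext)
qed

lemma beta_inj: "inj_on (beta A) (vcarrier A)"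
proof (rule inj_onI, rule ccontr)
  fix a b assume ab: "a \<in> vcarrier A" "b \<in> vcarrier A" "beta A a = beta A b" "a \<noteq> b"
  obtain v where v: "v \<in> vhom A L_alg" "v a \<noteq> v b" using hom_separates[OF ab(1,2,4)] by blast
  then show False using fun_cong[OF ab(3), of v] ab(1,2) by (simp add: beta_apply)
qed

text \<open>By construction \<open>v\<close> belongs to \<alpha> of its own image. Since that image
  is a subalgebra, the \<alpha>-condition on a morphism can be used at it.\<close>

lemma hom_image_SigmaL: "v \<in> vhom A L_alg \<Longrightarrow> v ` vcarrier A \<in> SigmaL"
  unfolding SigmaL_def
proof (intro CollectI conjI ballI allI)
  assume v: "v \<in> vhom A L_alg"
  show "bot \<in> v ` vcarrier A" "top \<in> v ` vcarrier A"
    using vhom_LD(5,6)[OF v] closed(1,2) by (metis imageI)+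
  show "TL p x \<in> v ` vcarrier A" if "x \<in> v ` vcarrier A" for p x
    using that vhom_LD(4)[OF v] closed(6) by (metis image_iff)
  fix x y assume "x \<in> v ` vcarrier A" "y \<in> v ` vcarrier A"
  then obtain a b where ab: "a \<in> vcarrier A" "b \<in> vcarrier A" "x = v a" "y = v b" by blast
  show "inf x y \<in> v ` vcarrier A" "sup x y \<in> v ` vcarrier A" "himpL x y \<in> v ` vcarrier A"
    using vhom_LD(1-3)[OF v ab(1,2)] closed(3-5)[OF ab(1,2)] ab(3,4) by (metis imageI)+
qed

text \<open>The meet of \<open>a i\<close> with \<open>vT A top (b i)\<close> has value
  \<open>f v\<close> where \<open>v (b i) = top\<close> and \<open>bot\<close> elsewhere. Joining
  such terms is consistent on overlaps, since every term not cut off to \<open>bot\<close> there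
  equals \<open>f v\<close>.\<close>

lemma glue_finite:
  assumes "finite S" "\<And>i. i \<in> S \<Longrightarrow> a i \<in> vcarrier A \<and> b i \<in> vcarrier A"
    "\<And>i v. i \<in> S \<Longrightarrow> v \<in> basic_open A (b i) \<Longrightarrow> v (a i) = f v"
  shows "\<exists>c\<in>vcarrier A. \<forall>v\<in>vhom A L_alg. v c = (if \<exists>i\<in>S. v (b i) = top then f v else bot)"
  using assms
proof (induction rule: finite_induct)
  case empty
  show ?case by (intro bexI[of _ "vzero A"]) (auto simp: vhom_LD)
next
  case (insert i S)
  then obtain c where c: "c \<in> vcarrier A"
    "\<forall>v\<in>vhom A L_alg. v c = (if \<exists>i\<in>S. v (b i) = top then f v else bot)" by auto
  have ab: "a i \<in> vcarrier A" "b i \<in> vcarrier A" using insert.prems by auto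
  have val: "v (a i) = f v" if "v \<in> vhom A L_alg" "v (b i) = top" for v
    using insert.prems(2)[of i v] that by (auto simp: basic_open_def)
  show ?case
  proof (intro bexI ballI)
    let ?d = "vjoin A (vmeet A (a i) (vT A top (b i))) c"
    show "?d \<in> vcarrier A" using ab c by blast
    fix v assume v: "v \<in> vhom A L_alg"
    have "v ?d = sup (inf (v (a i)) (TL top (v (b i)))) (v c)"
      using v ab c(1) by (simp add: vhom_LD)
    then show "v ?d = (if \<exists>j\<in>insert i S. v (b j) = top then f v else bot)"
      using c(2)[rule_format, OF v] val[OF v] by (simp add: TL_def)
  qed
qed

text \<open>Surjectivity: at each \<open>v\<close>, a morphism \<open>f\<close> takes a value in the subalgebra \<open>v(A)\<close>, so it
  agrees with some \<open>a \<in> A\<close> near \<open>v\<close>; finitely many such local representatives are glued.\<close>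

lemma beta_surj:
  assumes f: "f \<in> pbs_hom (Gobj A) L_pbs"
  shows "\<exists>c\<in>vcarrier A. beta A c = f"
proof -
  have fext: "f \<in> extensional (vhom A L_alg)"
    and fc: "continuous_map (ptop1 (Gobj A)) (discrete_topology UNIV) f"
    and fa: "\<And>L'. L' \<in> SigmaL \<Longrightarrow> f ` palpha (Gobj A) L' \<subseteq> L'"
    using f by (auto simp: pbs_hom_def pspace_Gobj PiE_iff)
  have "\<exists>a b. a \<in> vcarrier A \<and> b \<in> vcarrier A \<and> v \<in> basic_open A b \<and>
      (\<forall>w\<in>basic_open A b. w a = f w)" if v: "v \<in> vhom A L_alg" for v
  proof -
    have "v \<in> palpha (Gobj A) (v ` vcarrier A)" using v by (simp add: palpha_Gobj)
    then have "f v \<in> v ` vcarrier A" using fa[OF hom_image_SigmaL[OF v]] by blast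
    then obtain a where a: "a \<in> vcarrier A" "v a = f v" by (metis imageE)
    have "openin (ptop1 (Gobj A)) {w \<in> pspace (Gobj A). w a = f w}"
      by (rule continuous_map_discrete_eq_clopen(1)[OF eval_continuous[OF a(1)] fc])
    then obtain b where "b \<in> vcarrier A" "v \<in> basic_open A b"
      "basic_open A b \<subseteq> {w \<in> pspace (Gobj A). w a = f w}"
      using basic_open_base[of "{w \<in> pspace (Gobj A). w a = f w}" v] a v by (auto simp: pspace_Gobj)
    then show ?thesis using a by blast
  qed
  then obtain a b where ab: "\<And>v. v \<in> vhom A L_alg \<Longrightarrow> a v \<in> vcarrier A \<and> b v \<in> vcarrier A \<and>
      v \<in> basic_open A (b v) \<and> (\<forall>w\<in>basic_open A (b v). w (a v) = f w)"
    by metis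
  have "(\<forall>U\<in>(\<lambda>v. basic_open A (b v)) ` vhom A L_alg. openin (ptop1 (Gobj A)) U) \<and>
      topspace (ptop1 (Gobj A)) \<subseteq> \<Union>((\<lambda>v. basic_open A (b v)) ` vhom A L_alg)"
    using ab openin_basic pspace_Gobj by blast
  then obtain \<V> where \<V>: "finite \<V>" "\<V> \<subseteq> (\<lambda>v. basic_open A (b v)) ` vhom A L_alg"
    "vhom A L_alg \<subseteq> \<Union>\<V>"
    using compact_Gobj unfolding compact_space_alt pspace_Gobj by meson
  obtain S where S: "S \<subseteq> vhom A L_alg" "finite S" "\<V> = (\<lambda>v. basic_open A (b v)) ` S"
    using finite_subset_image[OF \<V>(1,2)] by blast
  obtain c where c: "c \<in> vcarrier A"
    "\<forall>v\<in>vhom A L_alg. v c = (if \<exists>i\<in>S. v (b i) = top then f v else bot)"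
    using glue_finite[OF S(2), of a b f] ab S(1) by blast
  have "v c = f v" if v: "v \<in> vhom A L_alg" for v
  proof -
    have "\<exists>i\<in>S. v (b i) = top" using v \<V>(3) S(3) by (auto simp: basic_open_def)
    then show ?thesis using bspec[OF c(2) v] by simp
  qed
  then have "beta A c = f"
    using fext c(1) by (intro extensionalityI[of _ "vhom A L_alg"]) (auto simp: beta_apply)
  then show ?thesis using c(1) by blast
qed

lemma beta_bij: "bij_betw (beta A) (vcarrier A) (vcarrier (Fobj (Gobj A)))"
  unfolding bij_betw_def Fobj_simps using beta_inj beta_carrier beta_surj by (auto simp: image_iff)

end

section \<open>The algebra of a space\<close>

lemma restrict_eq_restrict_iff: "restrict f S = restrict g S \<longleftrightarrow> (\<forall>s\<in>S. f s = g s)"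
  by (metis restrict_apply' restrict_ext)

lemma restrict_eq_iff_extensional:
  "g \<in> extensional S \<Longrightarrow> restrict f S = g \<longleftrightarrow> (\<forall>s\<in>S. f s = g s)"
  by (metis extensional_restrict restrict_eq_restrict_iff)

lemma le_foldr_sup: "x \<in> set xs \<Longrightarrow> x \<le> foldr sup xs (bot::'a::bounded_lattice)"
  by (induction xs) (auto intro: le_supI2)

lemma foldr_inf_le: "x \<in> set xs \<Longrightarrow> foldr inf xs (top::'a::bounded_lattice) \<le> x"
  by (induction xs) (auto intro: le_infI2)

text \<open>\<open>vle\<close> equates \<open>f\<close> with a meet restricted to the space, so
  \<open>f\<close> has to be extensional for the pointwise order to imply it.\<close>

lemma vle_Fobj_iff:
  "f \<in> extensional (pspace B) \<Longrightarrow> vle (Fobj B) f g \<longleftrightarrow> (\<forall>s\<in>pspace B. f s \<le> g s)"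
  by (simp add: vle_def restrict_eq_iff_extensional inf.absorb_iff1)

lemma vBigJoin_Fobj:
  "vBigJoin (Fobj B) F = (\<lambda>s\<in>pspace B. foldr sup (map (\<lambda>l. F l s) lvals) bot)"
proof -
  have "foldr (vjoin (Fobj B)) (map F xs) (vzero (Fobj B)) =
      (\<lambda>s\<in>pspace B. foldr sup (map (\<lambda>l. F l s) xs) bot)" for xs
    by (induction xs) (auto intro!: restrict_ext)
  then show ?thesis by (simp add: vBigJoin_def)
qed

lemma vBigMeet_Fobj:
  "vBigMeet (Fobj B) F = (\<lambda>s\<in>pspace B. foldr inf (map (\<lambda>l. F l s) lvals) top)"
proof -
  have "foldr (vmeet (Fobj B)) (map F xs) (vone (Fobj B)) =
      (\<lambda>s\<in>pspace B. foldr inf (map (\<lambda>l. F l s) xs) top)" for xs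
    by (induction xs) (auto intro!: restrict_ext)
  then show ?thesis by (simp add: vBigMeet_def)
qed

locale pbs_space =
  fixes B :: "('l::finite_distrib_lattice, 'b) pbs"
  assumes nontriv: "(bot::'l) \<noteq> top" and obj: "pbs_obj B"
begin

lemma ptop2_eq: "ptop2 B = ptop1 B" and stone: "stone_space (ptop1 B)"
  using obj by (auto simp: pbs_obj_def pairwise_boolean_iff)

lemma palpha_closed: "L' \<in> SigmaL \<Longrightarrow> closedin (ptop1 B) (palpha B L')"
  using obj by (auto simp: pbs_obj_def pairwise_closed_def)

lemma palpha_subset: "L' \<in> SigmaL \<Longrightarrow> palpha B L' \<subseteq> pspace B"
  using palpha_closed closedin_subset by blast

lemma palpha_UNIV: "palpha B UNIV = pspace B"
  using obj by (simp add: pbs_obj_def)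

lemma palpha_Int: "L2 \<in> SigmaL \<Longrightarrow> L3 \<in> SigmaL \<Longrightarrow> palpha B (L2 \<inter> L3) = palpha B L2 \<inter> palpha B L3"
  using obj by (simp add: pbs_obj_def)

lemma pbs_hom_L_iff:
  "f \<in> pbs_hom B L_pbs \<longleftrightarrow> f \<in> extensional (pspace B) \<and>
     continuous_map (ptop1 B) (discrete_topology UNIV) f \<and>
     (\<forall>L'\<in>SigmaL. \<forall>s\<in>palpha B L'. f s \<in> L')"
  by (auto simp: pbs_hom_def ptop2_eq PiE_iff)

text \<open>This treats all operations at once: \<open>h\<close> may be any binary operation
  preserving every subalgebra, and T is supplied as one that ignores its second argument.\<close>

lemma pbs_hom_L_binop:
  assumes f: "f \<in> pbs_hom B L_pbs" and g: "g \<in> pbs_hom B L_pbs"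
    and h: "\<And>L' x y. L' \<in> SigmaL \<Longrightarrow> x \<in> L' \<Longrightarrow> y \<in> L' \<Longrightarrow> h x y \<in> L'"
  shows "(\<lambda>s\<in>pspace B. h (f s) (g s)) \<in> pbs_hom B L_pbs"
  unfolding pbs_hom_L_iff
proof (intro conjI ballI)
  have "continuous_map (ptop1 B) (discrete_topology UNIV) (\<lambda>s. h (f s) (g s))"
    using f g unfolding pbs_hom_L_iff
    by (intro continuous_map_discrete_binop[of "ptop1 B" f g h]) blast+
  then show "continuous_map (ptop1 B) (discrete_topology UNIV) (\<lambda>s\<in>pspace B. h (f s) (g s))"
    by (rule continuous_map_eq) simp
  show "(\<lambda>s\<in>pspace B. h (f s) (g s)) s \<in> L'" if "L' \<in> SigmaL" "s \<in> palpha B L'" for s L'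
  proof -
    have "s \<in> pspace B" using palpha_subset that by blast
    moreover have "f s \<in> L'" "g s \<in> L'" using f g that unfolding pbs_hom_L_iff by blast+
    ultimately show ?thesis using h[OF that(1)] by simp
  qed
qed simp

lemma Fobj_closed:
  "vzero (Fobj B) \<in> pbs_hom B L_pbs" "vone (Fobj B) \<in> pbs_hom B L_pbs"
  "f \<in> pbs_hom B L_pbs \<Longrightarrow> g \<in> pbs_hom B L_pbs \<Longrightarrow> vmeet (Fobj B) f g \<in> pbs_hom B L_pbs"
  "f \<in> pbs_hom B L_pbs \<Longrightarrow> g \<in> pbs_hom B L_pbs \<Longrightarrow> vjoin (Fobj B) f g \<in> pbs_hom B L_pbs"
  "f \<in> pbs_hom B L_pbs \<Longrightarrow> g \<in> pbs_hom B L_pbs \<Longrightarrow> vimp (Fobj B) f g \<in> pbs_hom B L_pbs"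
  "f \<in> pbs_hom B L_pbs \<Longrightarrow> vT (Fobj B) l f \<in> pbs_hom B L_pbs"
proof -
  \<comment> \<open>The values \<open>bot\<close> and \<open>top\<close> lie in every subalgebra, as
    the \<alpha>-condition demands of a constant map.\<close>
  have const: "(\<lambda>s\<in>pspace B. c) \<in> pbs_hom B L_pbs" if "c = bot \<or> c = top" for c
    unfolding pbs_hom_L_iff
  proof (intro conjI ballI)
    show "continuous_map (ptop1 B) (discrete_topology UNIV) (\<lambda>s\<in>pspace B. c)"
      by (rule continuous_map_eq[of _ _ "\<lambda>_. c"]) auto
    show "(\<lambda>s\<in>pspace B. c) s \<in> L'" if "L' \<in> SigmaL" "s \<in> palpha B L'" for s L'
      using that palpha_subset[of L'] SigmaLD(1,2)[of L'] \<open>c = bot \<or> c = top\<close> by auto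
  qed simp
  show "vzero (Fobj B) \<in> pbs_hom B L_pbs" "vone (Fobj B) \<in> pbs_hom B L_pbs"
    by (simp_all add: const)
  show "f \<in> pbs_hom B L_pbs \<Longrightarrow> vT (Fobj B) l f \<in> pbs_hom B L_pbs"
    using pbs_hom_L_binop[of f f "\<lambda>x _. TL l x"] SigmaLD(3) by auto
  assume fg: "f \<in> pbs_hom B L_pbs" "g \<in> pbs_hom B L_pbs"
  show "vmeet (Fobj B) f g \<in> pbs_hom B L_pbs" "vjoin (Fobj B) f g \<in> pbs_hom B L_pbs"
    "vimp (Fobj B) f g \<in> pbs_hom B L_pbs"
    using pbs_hom_L_binop[OF fg, of inf] pbs_hom_L_binop[OF fg, of sup]
      pbs_hom_L_binop[OF fg, of himpL] SigmaLD(4-6) by auto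
qed

lemma pbs_hom_L_ext: "f \<in> pbs_hom B L_pbs \<Longrightarrow> f \<in> extensional (pspace B)"
  by (simp add: pbs_hom_L_iff)

lemma heyting_Fobj: "heyting_alg (Fobj B)"
proof -
  note eqs = restrict_eq_restrict_iff restrict_eq_iff_extensional[OF pbs_hom_L_ext]
  show ?thesis
    unfolding heyting_alg_def Fobj_simps(1)
  proof (intro conjI ballI)
    fix f g h assume f: "f \<in> pbs_hom B L_pbs" and g: "g \<in> pbs_hom B L_pbs" and h: "h \<in> pbs_hom B L_pbs"
    show "vle (Fobj B) (vmeet (Fobj B) h f) g \<longleftrightarrow> vle (Fobj B) h (vimp (Fobj B) f g)"
      using h by (subst (1 2) vle_Fobj_iff) (auto simp: pbs_hom_L_ext inf_le_iff_le_himpL)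
  qed (use Fobj_closed in \<open>auto simp: eqs inf.commute inf.left_commute inf.assoc sup.commute sup.left_commute sup.assoc\<close>)
qed

text \<open>The operations are pointwise, so each axiom reduces to its instance in L, where
  \<open>TL l\<close> is the characteristic function of \<open>l\<close>. The preliminary facts
  settle these instances.\<close>

lemma vl_alg_Fobj: "vl_alg (Fobj B)"
proof -
  let ?F = "Fobj B"
  have join: "vBigJoin ?F (\<lambda>l. vT ?F l a) = vone ?F" for a
  proof -
    have "foldr sup (map (\<lambda>l. TL l (a s)) lvals) bot = top" for s
    proof -
      have "top \<in> set (map (\<lambda>l. TL l (a s)) lvals)"
        by (auto simp: TL_def set_lvals image_iff)
      from le_foldr_sup[OF this] show ?thesis by (simp add: top_unique)
    qed
    then show ?thesis
      unfolding vBigJoin_Fobj by (auto simp: restrict_eq_restrict_iff cong: map_cong)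
  qed
  have meet: "vle ?F (vBigMeet ?F (\<lambda>l. viff ?F (vT ?F l a) (vT ?F l b))) (viff ?F a b)" for a b
  proof -
    have "foldr inf (map (\<lambda>l. inf (himpL (TL l x) (TL l y)) (himpL (TL l y) (TL l x))) lvals) top
        \<le> inf (himpL x y) (himpL y x)" for x y :: 'l
    proof (cases "x = y")
      case True
      then show ?thesis by simp
    next
      case False
      \<comment> \<open>For \<open>x \<noteq> y\<close> the single factor with \<open>l = x\<close>
        is already \<open>bot\<close>.\<close>
      have "inf (himpL (TL x x) (TL x y)) (himpL (TL x y) (TL x x)) = bot"
        using False by (auto simp: TL_def)
      moreover have "inf (himpL (TL x x) (TL x y)) (himpL (TL x y) (TL x x)) \<in>
          set (map (\<lambda>l. inf (himpL (TL l x) (TL l y)) (himpL (TL l y) (TL l x))) lvals)"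
        by (simp add: set_lvals)
      ultimately have "foldr inf (map (\<lambda>l. inf (himpL (TL l x) (TL l y)) (himpL (TL l y) (TL l x))) lvals) top \<le> bot"
        using foldr_inf_le by metis
      then show ?thesis using bot_least order_trans by blast
    qed
    then show ?thesis
      unfolding vBigMeet_Fobj by (subst vle_Fobj_iff) (auto simp: viff_def cong: map_cong)
  qed
  have neg: "sup (TL l x) (himpL (TL l x) bot) = top" for l x :: 'l
    by (auto simp: TL_def himpL_eq_top_iff)
  have T_op: "inf (TL p x) (TL q y) \<le> inf (TL (himpL p q) (himpL x y))
      (inf (TL (inf p q) (inf x y)) (TL (sup p q) (sup x y)))"
    "TL q x \<le> TL (TL p q) (TL p x)" for p q x y :: 'l
    by (auto simp: TL_def)
  have TT: "TL top (TL l x) = TL l x" "TL bot (TL l x) = himpL (TL l x) bot"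
    "m \<noteq> bot \<Longrightarrow> m \<noteq> top \<Longrightarrow> TL m (TL l x) = bot" for l m x :: 'l
    using nontriv by (auto simp: TL_def himpL_eq_top_iff)
  have top: "TL top x \<le> x" "TL top (inf x y) = inf (TL top x) (TL top y)" for x y :: 'l
    by (auto simp: TL_def)
  show ?thesis
    unfolding vl_alg_def
  proof (intro conjI ballI allI impI)
    show "heyting_alg ?F" by (rule heyting_Fobj)
    show "vT ?F l x \<in> vcarrier ?F" if "x \<in> vcarrier ?F" for l x
      using that Fobj_closed(6) by (simp only: Fobj_simps(1))
    show "vle ?F (vmeet ?F (vT ?F p a) (vT ?F q b))
       (vmeet ?F (vT ?F (himpL p q) (vimp ?F a b))
         (vmeet ?F (vT ?F (inf p q) (vmeet ?F a b)) (vT ?F (sup p q) (vjoin ?F a b))))" for p q a b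
      using T_op(1) by (subst vle_Fobj_iff) auto
    show "vle ?F (vT ?F q a) (vT ?F (TL p q) (vT ?F p a))" for p q a
      using T_op(2) by (subst vle_Fobj_iff) auto
    show "vT ?F bot (vzero ?F) = vone ?F" "vT ?F top (vone ?F) = vone ?F"
      by (simp_all add: restrict_eq_restrict_iff TL_def)
    show "vT ?F l (vzero ?F) = vzero ?F" if "l \<noteq> bot" for l
      using that by (simp add: restrict_eq_restrict_iff TL_def)
    show "vT ?F l (vone ?F) = vzero ?F" if "l \<noteq> top" for l
      using that by (simp add: restrict_eq_restrict_iff TL_def)
    show "vBigJoin ?F (\<lambda>l. vT ?F l a) = vone ?F" for a by (rule join)
    show "vjoin ?F (vT ?F l a) (vimp ?F (vT ?F l a) (vzero ?F)) = vone ?F" for l a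
      using neg by (simp add: restrict_eq_restrict_iff)
    show "vmeet ?F (vT ?F l a) (vT ?F m a) = vzero ?F" if "l \<noteq> m" for l m a
      using that by (simp add: restrict_eq_restrict_iff TL_def)
    show "vT ?F top (vT ?F l a) = vT ?F l a" "vT ?F bot (vT ?F l a) = vimp ?F (vT ?F l a) (vzero ?F)" for l a
      by (simp_all add: restrict_eq_restrict_iff TT)
    show "vT ?F m (vT ?F l a) = vzero ?F" if "m \<noteq> bot \<and> m \<noteq> top" for l m a
      using that by (simp add: restrict_eq_restrict_iff TT)
    show "vle ?F (vT ?F top a) a" for a
      using top(1) by (subst vle_Fobj_iff) auto
    show "vT ?F top (vmeet ?F a b) = vmeet ?F (vT ?F top a) (vT ?F top b)" for a b
      by (simp add: restrict_eq_restrict_iff top)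
    show "vle ?F (vBigMeet ?F (\<lambda>l. viff ?F (vT ?F l a) (vT ?F l b))) (viff ?F a b)" for a b
      by (rule meet)
  qed
qed

text \<open>This makes the results on dual spaces available for G(F(B)).\<close>

sublocale F: vl_algebra "Fobj B"
  using nontriv vl_alg_Fobj by unfold_locales

text \<open>Outside \<open>K\<close> the value \<open>bot\<close> lies in every subalgebra. On
  \<open>K\<close> the value \<open>l\<close> must lie in each \<open>L'\<close> whose \<alpha>-set
  meets \<open>K\<close>, which is what the last assumption says.\<close>

lemma step_in_pbs_hom:
  assumes K: "openin (ptop1 B) K" "closedin (ptop1 B) K"
    and l: "\<And>L'. L' \<in> SigmaL \<Longrightarrow> l \<notin> L' \<Longrightarrow> K \<inter> palpha B L' = {}"
  shows "(\<lambda>s\<in>pspace B. if s \<in> K then l else bot) \<in> pbs_hom B L_pbs" (is "?f \<in> _")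
  unfolding pbs_hom_L_iff
proof (intro conjI ballI)
  have sub: "K \<subseteq> pspace B" using openin_subset K by blast
  show "continuous_map (ptop1 B) (discrete_topology UNIV) ?f"
    unfolding continuous_map_discrete_iff
  proof
    fix m
    \<comment> \<open>The union form includes the case \<open>l = bot\<close>, where both parts
      contribute to the same fibre.\<close>
    have "{s \<in> pspace B. ?f s = m} =
        (if m = l then K else {}) \<union> (if m = bot then pspace B - K else {})"
      using sub by auto
    then show "openin (ptop1 B) {s \<in> pspace B. ?f s = m}"
      using K by (auto simp: closedin_def)
  qed
  show "?f s \<in> L'" if "L' \<in> SigmaL" "s \<in> palpha B L'" for L' s
    using that l[of L'] palpha_subset[of L'] SigmaLD(1)[of L'] by auto
qed simp

lemma clopen_nbhd:
  assumes "closedin (ptop1 B) C" "s \<in> pspace B" "s \<notin> C"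
  shows "\<exists>K. openin (ptop1 B) K \<and> closedin (ptop1 B) K \<and> s \<in> K \<and> K \<inter> C = {}"
proof -
  have "openin (ptop1 B) (pspace B - C)" using assms(1) by (simp add: closedin_def)
  then obtain K where "openin (ptop1 B) K" "closedin (ptop1 B) K" "s \<in> K" "K \<subseteq> pspace B - C"
    using stone assms unfolding stone_space_def by blast
  then show ?thesis by blast
qed

section \<open>The evaluation map from a space to its double dual\<close>

lemma zeta_apply: "s \<in> pspace B \<Longrightarrow> zeta B s = (\<lambda>\<psi>\<in>pbs_hom B L_pbs. \<psi> s)"
  by (simp add: zeta_def)

lemma zeta_in_vhom:
  assumes s: "s \<in> pspace B" shows "zeta B s \<in> vhom (Fobj B) L_alg"
  unfolding vhom_def Fobj_simps(1)
  using Fobj_closed s by (simp add: zeta_apply)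

lemma zeta_inj: "inj_on (zeta B) (pspace B)"
proof (rule inj_onI, rule ccontr)
  fix s t assume st: "s \<in> pspace B" "t \<in> pspace B" "zeta B s = zeta B t" "s \<noteq> t"
  have "closedin (ptop1 B) {t}"
    using stone st closedin_Hausdorff_sing_eq unfolding stone_space_def by metis
  then obtain K where K: "openin (ptop1 B) K" "closedin (ptop1 B) K" "s \<in> K" "K \<inter> {t} = {}"
    using clopen_nbhd[of "{t}" s] st by auto
  \<comment> \<open>The value \<open>top\<close> lies in every subalgebra, so \<alpha> puts no
    constraint on the clopen set \<open>K\<close>.\<close>
  let ?f = "\<lambda>s\<in>pspace B. if s \<in> K then top else bot"
  have "?f \<in> pbs_hom B L_pbs"
    by (rule step_in_pbs_hom[OF K(1,2)]) (simp add: SigmaLD(2))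
  then show False
    using fun_cong[OF st(3), of ?f] st(1,2) K(3,4) nontriv by (simp add: zeta_apply)
qed

lemma zeta_surj:
  assumes v: "v \<in> vhom (Fobj B) L_alg"
  shows "\<exists>s\<in>pspace B. zeta B s = v"
proof (rule ccontr)
  assume neg: "\<not> ?thesis"
  define \<X> where "\<X> = {\<xi> \<in> pbs_hom B L_pbs. v \<xi> = top}"
  define Z where "Z \<xi> = {s \<in> pspace B. \<xi> s = (bot::'l)}" for \<xi>
  have cover: "\<exists>\<xi>\<in>\<X>. s \<in> Z \<xi>" if s: "s \<in> pspace B" for s
  proof -
    have vext: "v \<in> extensional (pbs_hom B L_pbs)" using vhomD(1)[OF v] by simp
    have "\<not> (\<forall>\<psi>\<in>pbs_hom B L_pbs. \<psi> s = v \<psi>)"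
      using neg s by (auto simp: zeta_apply restrict_eq_iff_extensional[OF vext, symmetric])
    then obtain \<psi> where \<psi>: "\<psi> \<in> pbs_hom B L_pbs" "v \<psi> \<noteq> \<psi> s" by metis
    \<comment> \<open>Applying T with index \<open>v \<psi>\<close> sharpens the disagreement at
      \<open>s\<close> to extreme values: \<open>v\<close> gives 1 and evaluation at
      \<open>s\<close> gives 0.\<close>
    let ?\<xi> = "vT (Fobj B) (v \<psi>) \<psi>"
    have "v ?\<xi> = top" using vhom_LD(4)[OF v, of \<psi> "v \<psi>"] \<psi>(1) by (simp add: TL_def)
    moreover have "?\<xi> s = bot" using s \<psi>(2) by (simp add: TL_def)
    ultimately show ?thesis
      using s Fobj_closed(6)[OF \<psi>(1)] unfolding \<X>_def Z_def by blast
  qed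
  have "openin (ptop1 B) (Z \<xi>)" if "\<xi> \<in> \<X>" for \<xi>
    using that unfolding \<X>_def Z_def pbs_hom_L_iff continuous_map_discrete_iff by blast
  then have "(\<forall>U\<in>Z ` \<X>. openin (ptop1 B) U) \<and> pspace B \<subseteq> \<Union>(Z ` \<X>)"
    using cover by blast
  moreover have "compact_space (ptop1 B)" using stone by (simp add: stone_space_def)
  ultimately obtain \<V> where \<V>: "finite \<V>" "\<V> \<subseteq> Z ` \<X>" "pspace B \<subseteq> \<Union>\<V>"
    unfolding compact_space_alt by meson
  obtain S where S: "S \<subseteq> \<X>" "finite S" "\<V> = Z ` S"
    using finite_subset_image[OF \<V>(1,2)] by blast
  \<comment> \<open>\<open>\<X>\<close> contains the constant 1 and is closed under meets, so a
    single member can vanish on all of the finite subcover.\<close>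
  have "\<exists>\<xi>\<in>\<X>. \<forall>s\<in>\<Union>(Z ` S). \<xi> s = bot"
    using S(2,1)
  proof (induction rule: finite_induct)
    case empty
    have "vone (Fobj B) \<in> \<X>"
      unfolding \<X>_def using vhom_LD(6)[OF v] Fobj_closed(2) by blast
    then show ?case by blast
  next
    case (insert \<psi> S)
    then obtain \<xi> where \<xi>: "\<xi> \<in> \<X>" "\<forall>s\<in>\<Union>(Z ` S). \<xi> s = bot" by auto
    have mem: "\<psi> \<in> pbs_hom B L_pbs" "\<xi> \<in> pbs_hom B L_pbs" "v \<psi> = top" "v \<xi> = top"
      using \<xi> insert.prems by (auto simp: \<X>_def)
    have "v (vmeet (Fobj B) \<psi> \<xi>) = top"
      using vhom_LD(1)[OF v, of \<psi> \<xi>] mem by simp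
    then have "vmeet (Fobj B) \<psi> \<xi> \<in> \<X>"
      unfolding \<X>_def using Fobj_closed(3)[OF mem(1,2)] by blast
    moreover have "\<forall>s\<in>\<Union>(Z ` insert \<psi> S). vmeet (Fobj B) \<psi> \<xi> s = bot"
      using \<xi>(2) by (auto simp: Z_def)
    ultimately show ?case by blast
  qed
  then obtain \<xi> where \<xi>: "\<xi> \<in> \<X>" "\<forall>s\<in>pspace B. \<xi> s = bot"
    using \<V>(3) S(3) by blast
  then have "vzero (Fobj B) = \<xi>"
    using pbs_hom_L_ext[of \<xi>] by (simp add: \<X>_def restrict_eq_iff_extensional)
  then show False
    using \<xi>(1) vhom_LD(5)[OF v] nontriv by (simp add: \<X>_def)
qed

lemma zeta_continuous: "continuous_map (ptop1 B) (ptop1 (Gobj (Fobj B))) (zeta B)"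
proof -
  have "continuous_map (ptop1 B) (topology_generated_by (basic_open (Fobj B) ` vcarrier (Fobj B))) (zeta B)"
  proof (rule continuous_on_generated_topo)
    fix U assume "U \<in> basic_open (Fobj B) ` vcarrier (Fobj B)"
    then obtain \<psi> where \<psi>: "\<psi> \<in> pbs_hom B L_pbs" "U = basic_open (Fobj B) \<psi>" by auto
    then have "zeta B -` U \<inter> pspace B = {s \<in> pspace B. \<psi> s = top}"
      using zeta_in_vhom by (auto simp: basic_open_def zeta_apply)
    then show "openin (ptop1 B) (zeta B -` U \<inter> pspace B)"
      using \<psi>(1) by (simp add: pbs_hom_L_iff continuous_map_discrete_iff)
  next
    show "zeta B ` pspace B \<subseteq> \<Union> (basic_open (Fobj B) ` vcarrier (Fobj B))"
      using F.pspace_Gobj zeta_in_vhom by (auto simp: Gobj_def)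
  qed
  then show ?thesis by (simp add: Gobj_def)
qed

lemma zeta_image: "zeta B ` pspace B = pspace (Gobj (Fobj B))"
  unfolding F.pspace_Gobj using zeta_surj zeta_in_vhom by blast

lemma zeta_homeomorphic: "homeomorphic_map (ptop1 B) (ptop1 (Gobj (Fobj B))) (zeta B)"
  using continuous_imp_homeomorphic_map[OF zeta_continuous _ _ zeta_image zeta_inj] stone F.stone_Gobj
  by (simp add: stone_space_def)

lemma zeta_palpha:
  assumes "L' \<in> SigmaL" "s \<in> palpha B L'" shows "zeta B s \<in> palpha (Gobj (Fobj B)) L'"
proof -
  have s: "s \<in> pspace B" using assms palpha_subset by blast
  show ?thesis
    using assms zeta_in_vhom[OF s] s by (auto simp: F.palpha_Gobj zeta_apply pbs_hom_L_iff)
qed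

lemma zeta_pbs_hom: "zeta B \<in> pbs_hom B (Gobj (Fobj B))"
proof -
  have "zeta B \<in> pspace B \<rightarrow>\<^sub>E pspace (Gobj (Fobj B))"
    using zeta_image by (auto simp: PiE_iff zeta_def)
  then show ?thesis
    unfolding pbs_hom_def using zeta_continuous zeta_palpha by (auto simp: ptop2_eq F.ptop2_Gobj)
qed

text \<open>Extends the binary law for \<alpha> to finite families; the empty one is covered by
  \<alpha>(L) being the whole space. As L is finite, this yields a least subalgebra whose
  \<alpha>-set contains \<open>s\<close>.\<close>

lemma palpha_Inter:
  assumes "finite \<S>" "\<S> \<subseteq> SigmaL" "\<And>L'. L' \<in> \<S> \<Longrightarrow> s \<in> palpha B L'" "s \<in> pspace B"
  shows "\<Inter>\<S> \<in> SigmaL \<and> s \<in> palpha B (\<Inter>\<S>)"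
  using assms
proof (induction rule: finite_induct)
  case empty
  then show ?case by (simp add: UNIV_in_SigmaL palpha_UNIV)
next
  case (insert L' \<S>)
  then have "L' \<in> SigmaL" "\<Inter>\<S> \<in> SigmaL" "s \<in> palpha B L'" "s \<in> palpha B (\<Inter>\<S>)" by simp_all
  then show ?case using palpha_Int[of L' "\<Inter>\<S>"] SigmaL_Int[of L' "\<Inter>\<S>"] by simp
qed

text \<open>Let \<open>M\<close> be the least subalgebra with \<open>s \<in> \<alpha>(M)\<close>. If \<open>s \<notin> \<alpha>(L')\<close>, some \<open>l \<in> M\<close> lies outside
  \<open>L'\<close>, and the map equal to \<open>l\<close> on a small clopen neighbourhood of \<open>s\<close> and to \<open>0\<close> elsewhere is a
  morphism.\<close>

lemma zeta_palpha_reflect: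
  assumes L': "L' \<in> SigmaL" and s: "s \<in> pspace B" and z: "zeta B s \<in> palpha (Gobj (Fobj B)) L'"
  shows "s \<in> palpha B L'"
proof (rule ccontr)
  assume ns: "s \<notin> palpha B L'"
  define M where "M = \<Inter>{N \<in> SigmaL. s \<in> palpha B N}"
  have M: "M \<in> SigmaL" "s \<in> palpha B M"
    using palpha_Inter[OF finite _ _ s, of "{N \<in> SigmaL. s \<in> palpha B N}"] unfolding M_def by blast+
  have "\<not> M \<subseteq> L'"
  proof
    assume "M \<subseteq> L'"
    then have "palpha B M = palpha B M \<inter> palpha B L'"
      using palpha_Int[OF M(1) L'] by (simp add: inf.absorb1)
    then show False using M ns by blast
  qed
  then obtain l where l: "l \<in> M" "l \<notin> L'" by blast
  \<comment> \<open>\<open>C\<close> collects the \<alpha>-sets on which the value \<open>l\<close>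
    is forbidden. It is a finite union of closed sets, and misses \<open>s\<close> because
    \<open>l\<close> lies in every \<open>N\<close> with \<open>s\<close> in
    \<open>palpha B N\<close>.\<close>
  define C where "C = \<Union>(palpha B ` {N \<in> SigmaL. l \<notin> N})"
  have "closedin (ptop1 B) C"
    unfolding C_def using palpha_closed by (intro closedin_Union) auto
  moreover have "s \<notin> C" unfolding C_def using l by (auto simp: M_def)
  ultimately obtain K where K: "openin (ptop1 B) K" "closedin (ptop1 B) K" "s \<in> K" "K \<inter> C = {}"
    using clopen_nbhd s by blast
  let ?f = "\<lambda>s\<in>pspace B. if s \<in> K then l else bot"
  have "?f \<in> pbs_hom B L_pbs"
    by (rule step_in_pbs_hom[OF K(1,2)]) (use K(4) in \<open>auto simp: C_def\<close>)
  then have "zeta B s ?f \<in> L'" using z by (auto simp: F.palpha_Gobj)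
  then show False using \<open>?f \<in> pbs_hom B L_pbs\<close> s K(3) l by (simp add: zeta_apply)
qed

text \<open>A homeomorphism is an isomorphism of the category only if its inverse also respects
  \<alpha>; this is \<open>zeta_palpha_reflect\<close>.\<close>

lemma zeta_inverse:
  "\<exists>\<theta>\<in>pbs_hom (Gobj (Fobj B)) B. (\<forall>s\<in>pspace B. \<theta> (zeta B s) = s) \<and>
     (\<forall>y\<in>pspace (Gobj (Fobj B)). zeta B (\<theta> y) = y)"
proof -
  let ?G = "Gobj (Fobj B)"
  obtain g where "homeomorphic_maps (ptop1 B) (ptop1 ?G) (zeta B) g"
    using zeta_homeomorphic homeomorphic_map_maps by blast
  then have g: "continuous_map (ptop1 ?G) (ptop1 B) g" "\<And>s. s \<in> pspace B \<Longrightarrow> g (zeta B s) = s"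
    "\<And>y. y \<in> pspace ?G \<Longrightarrow> zeta B (g y) = y"
    by (auto simp: homeomorphic_maps_def)
  \<comment> \<open>Morphisms are extensional, whereas \<open>g\<close> is arbitrary outside the
    space.\<close>
  define \<theta> where "\<theta> = restrict g (pspace ?G)"
  have c: "continuous_map (ptop1 ?G) (ptop1 B) \<theta>"
    unfolding \<theta>_def by (rule continuous_map_eq[OF g(1)]) simp
  have gin: "g y \<in> pspace B" if "y \<in> pspace ?G" for y
    using continuous_map_image_subset_topspace[OF g(1)] that by blast
  have "g y \<in> palpha B L'" if "L' \<in> SigmaL" "y \<in> palpha ?G L'" for L' y
  proof -
    have y: "y \<in> pspace ?G" using that by (simp add: F.palpha_Gobj F.pspace_Gobj)
    show ?thesis using zeta_palpha_reflect[OF that(1) gin[OF y]] g(3)[OF y] that(2) by simp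
  qed
  moreover have "palpha ?G L' \<subseteq> pspace ?G" for L' by (auto simp: F.palpha_Gobj F.pspace_Gobj)
  ultimately have "\<theta> \<in> pbs_hom ?G B"
    using c gin unfolding pbs_hom_def \<theta>_def
    by (auto simp: ptop2_eq F.ptop2_Gobj subset_iff)
  moreover have "\<forall>s\<in>pspace B. \<theta> (zeta B s) = s" "\<forall>y\<in>pspace ?G. zeta B (\<theta> y) = y"
    using g(2,3) zeta_image by (auto simp: \<theta>_def)
  ultimately show ?thesis by blast
qed

end

section \<open>Functoriality and naturality\<close>

lemma comp_vhom:
  assumes A: "vl_alg A" and g: "g \<in> vhom A C" and \<mu>: "\<mu> \<in> vhom C L_alg"
    and nt: "(bot::'l::finite_distrib_lattice) \<noteq> top"
  shows "(\<lambda>a\<in>vcarrier A. \<mu> (g a) :: 'l) \<in> vhom A L_alg"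
proof -
  interpret A: vl_algebra A using nt A by unfold_locales
  show ?thesis
    unfolding vhom_def
  proof (intro CollectI conjI ballI allI)
    show "(\<lambda>a\<in>vcarrier A. \<mu> (g a)) \<in> vcarrier A \<rightarrow>\<^sub>E vcarrier L_alg" by simp
    show "(\<lambda>a\<in>vcarrier A. \<mu> (g a)) (vzero A) = vzero L_alg"
      "(\<lambda>a\<in>vcarrier A. \<mu> (g a)) (vone A) = vone L_alg"
      using vhomD(7,8)[OF g] vhom_LD(5,6)[OF \<mu>] by simp_all
    fix a assume a: "a \<in> vcarrier A"
    show "(\<lambda>a\<in>vcarrier A. \<mu> (g a)) (vT A l a) = vT L_alg l ((\<lambda>a\<in>vcarrier A. \<mu> (g a)) a)" for l
      using a vhomD(6)[OF g a] vhom_LD(4)[OF \<mu> vhomD(2)[OF g a]] by simp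
    fix b assume b: "b \<in> vcarrier A"
    note ga = vhomD(2)[OF g a] vhomD(2)[OF g b]
    show "(\<lambda>a\<in>vcarrier A. \<mu> (g a)) (vmeet A a b) =
        vmeet L_alg ((\<lambda>a\<in>vcarrier A. \<mu> (g a)) a) ((\<lambda>a\<in>vcarrier A. \<mu> (g a)) b)"
      using a b vhomD(3)[OF g a b] vhom_LD(1)[OF \<mu> ga] by simp
    show "(\<lambda>a\<in>vcarrier A. \<mu> (g a)) (vjoin A a b) =
        vjoin L_alg ((\<lambda>a\<in>vcarrier A. \<mu> (g a)) a) ((\<lambda>a\<in>vcarrier A. \<mu> (g a)) b)"
      using a b vhomD(4)[OF g a b] vhom_LD(2)[OF \<mu> ga] by simp
    show "(\<lambda>a\<in>vcarrier A. \<mu> (g a)) (vimp A a b) =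
        vimp L_alg ((\<lambda>a\<in>vcarrier A. \<mu> (g a)) a) ((\<lambda>a\<in>vcarrier A. \<mu> (g a)) b)"
      using a b vhomD(5)[OF g a b] vhom_LD(3)[OF \<mu> ga] by simp
  qed
qed

text \<open>The preimage of the basic open set of \<open>a\<close> is that of \<open>g a\<close>.
  The \<alpha>-condition holds because composing with \<open>g\<close> adds no new values.\<close>

lemma Gmor_pbs_hom:
  fixes A :: "('l::finite_distrib_lattice, 'a) vl_struct" and C :: "('l, 'c) vl_struct"
  assumes nt: "(bot::'l) \<noteq> top" and A: "vl_alg A" and C: "vl_alg C" and g: "g \<in> vhom A C"
  shows "Gmor A C g \<in> pbs_hom (Gobj C) (Gobj A)"
proof -
  interpret A: vl_algebra A using nt A by unfold_locales
  interpret C: vl_algebra C using nt C by unfold_locales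
  have hom: "Gmor A C g \<mu> \<in> vhom A L_alg" if "\<mu> \<in> vhom C L_alg" for \<mu>
    using comp_vhom[OF A g that nt] that by (simp add: Gmor_def)
  have "continuous_map (ptop1 (Gobj C)) (topology_generated_by (basic_open A ` vcarrier A)) (Gmor A C g)"
  proof (rule continuous_on_generated_topo)
    fix U assume "U \<in> basic_open A ` vcarrier A"
    then obtain a where a: "a \<in> vcarrier A" "U = basic_open A a" by blast
    have "Gmor A C g -` U \<inter> pspace (Gobj C) = basic_open C (g a)"
      using a hom by (auto simp: basic_open_def C.pspace_Gobj Gmor_def)
    then show "openin (ptop1 (Gobj C)) (Gmor A C g -` U \<inter> pspace (Gobj C))"
      using C.openin_basic[OF vhomD(2)[OF g a(1)]] by simp
  next
    show "Gmor A C g ` pspace (Gobj C) \<subseteq> \<Union> (basic_open A ` vcarrier A)"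
      using A.pspace_Gobj hom by (auto simp: C.pspace_Gobj) (auto simp: Gobj_def)
  qed
  then have "continuous_map (ptop1 (Gobj C)) (ptop1 (Gobj A)) (Gmor A C g)"
    by (simp add: Gobj_def)
  moreover have "Gmor A C g \<mu> \<in> palpha (Gobj A) L'" if "\<mu> \<in> palpha (Gobj C) L'" for \<mu> L'
    using that hom[of \<mu>] vhomD(2)[OF g] by (auto simp: A.palpha_Gobj C.palpha_Gobj Gmor_def)
  ultimately show ?thesis
    using hom unfolding pbs_hom_def
    by (auto simp: A.ptop2_Gobj C.ptop2_Gobj A.pspace_Gobj C.pspace_Gobj) (auto simp: Gmor_def)
qed

lemma Fmor_vhom:
  fixes B :: "('l::finite_distrib_lattice, 'b) pbs" and D :: "('l, 'd) pbs"
  assumes nt: "(bot::'l) \<noteq> top" and B: "pbs_obj B" and D: "pbs_obj D" and \<phi>: "\<phi> \<in> pbs_hom B D"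
  shows "Fmor B D \<phi> \<in> vhom (Fobj D) (Fobj B)"
proof -
  interpret B: pbs_space B using nt B by unfold_locales
  interpret D: pbs_space D using nt D by unfold_locales
  have in_D: "\<phi> s \<in> pspace D" if "s \<in> pspace B" for s
    using \<phi> that by (auto simp: pbs_hom_def)
  have mem: "(\<lambda>s\<in>pspace B. \<eta> (\<phi> s)) \<in> pbs_hom B L_pbs" if \<eta>: "\<eta> \<in> pbs_hom D L_pbs" for \<eta>
    unfolding B.pbs_hom_L_iff
  proof (intro conjI ballI)
    have "continuous_map (ptop1 B) (ptop1 D) \<phi>"
      "continuous_map (ptop1 D) (discrete_topology UNIV) \<eta>"
      using \<phi> \<eta> by (auto simp: pbs_hom_def)
    from continuous_map_compose[OF this]
    show "continuous_map (ptop1 B) (discrete_topology UNIV) (\<lambda>s\<in>pspace B. \<eta> (\<phi> s))"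
      by (rule continuous_map_eq) simp
    show "(\<lambda>s\<in>pspace B. \<eta> (\<phi> s)) s \<in> L'" if "L' \<in> SigmaL" "s \<in> palpha B L'" for L' s
    proof -
      have "\<phi> s \<in> palpha D L'" using \<phi> that by (auto simp: pbs_hom_def)
      then show ?thesis
        using \<eta> that B.palpha_subset[OF that(1)] by (auto simp: D.pbs_hom_L_iff)
    qed
  qed simp
  show ?thesis
    unfolding vhom_def
  proof (intro CollectI conjI ballI allI)
    show "Fmor B D \<phi> \<in> vcarrier (Fobj D) \<rightarrow>\<^sub>E vcarrier (Fobj B)"
      using mem by (auto simp: Fmor_def)
    show "Fmor B D \<phi> (vzero (Fobj D)) = vzero (Fobj B)" "Fmor B D \<phi> (vone (Fobj D)) = vone (Fobj B)"
      using D.Fobj_closed(1,2) in_D by (auto simp: Fmor_def restrict_eq_restrict_iff)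
    fix f assume f: "f \<in> vcarrier (Fobj D)"
    show "Fmor B D \<phi> (vT (Fobj D) l f) = vT (Fobj B) l (Fmor B D \<phi> f)" for l
      using f D.Fobj_closed(6) in_D by (auto simp: Fmor_def restrict_eq_restrict_iff)
    fix g assume g: "g \<in> vcarrier (Fobj D)"
    show "Fmor B D \<phi> (vmeet (Fobj D) f g) = vmeet (Fobj B) (Fmor B D \<phi> f) (Fmor B D \<phi> g)"
      "Fmor B D \<phi> (vjoin (Fobj D) f g) = vjoin (Fobj B) (Fmor B D \<phi> f) (Fmor B D \<phi> g)"
      "Fmor B D \<phi> (vimp (Fobj D) f g) = vimp (Fobj B) (Fmor B D \<phi> f) (Fmor B D \<phi> g)"
      using f g D.Fobj_closed(3-5)[of f g] in_D by (auto simp: Fmor_def restrict_eq_restrict_iff)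
  qed
qed

lemma Gmor_id:
  assumes "\<mu> \<in> vhom A L_alg" shows "Gmor A A (\<lambda>x\<in>vcarrier A. x) \<mu> = \<mu>"
  using assms vhomD(1)[OF assms]
  by (simp add: Gmor_def restrict_eq_iff_extensional)

lemma Gmor_compose:
  assumes "vl_alg C" "g \<in> vhom A C" "h \<in> vhom C E" "\<mu> \<in> vhom E L_alg"
    "(bot::'l::finite_distrib_lattice) \<noteq> top"
  shows "Gmor A E (compose (vcarrier A) h g) (\<mu> :: _ \<Rightarrow> 'l) = Gmor A C g (Gmor C E h \<mu>)"
  using assms comp_vhom[OF assms(1,3,4,5)] vhomD(2)[OF assms(2)]
  by (auto simp: Gmor_def compose_def restrict_eq_restrict_iff)

lemma Fmor_id:
  assumes "\<eta> \<in> pbs_hom B L_pbs" shows "Fmor B B (\<lambda>x\<in>pspace B. x) \<eta> = \<eta>"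
proof -
  have "\<eta> \<in> extensional (pspace B)" using assms by (auto simp: pbs_hom_def PiE_iff)
  then show ?thesis using assms by (simp add: Fmor_def restrict_eq_iff_extensional)
qed

lemma Fmor_compose:
  fixes D :: "('l::finite_distrib_lattice, 'd) pbs"
  assumes "(bot::'l) \<noteq> top" "pbs_obj D" "pbs_obj E" "\<phi> \<in> pbs_hom B D" "\<psi> \<in> pbs_hom D E"
    "\<eta> \<in> pbs_hom E L_pbs"
  shows "Fmor B E (compose (pspace B) \<psi> \<phi>) \<eta> = Fmor B D \<phi> (Fmor D E \<psi> \<eta>)"
proof -
  have "Fmor D E \<psi> \<eta> \<in> pbs_hom D L_pbs"
    using vhomD(2)[OF Fmor_vhom[OF assms(1,2,3,5)], of \<eta>] assms(6) by simp
  moreover have "\<phi> s \<in> pspace D" if "s \<in> pspace B" for s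
    using assms(4) that by (auto simp: pbs_hom_def)
  ultimately show ?thesis
    using assms(6) by (auto simp: Fmor_def compose_def restrict_eq_restrict_iff)
qed

text \<open>Both sides send a homomorphism \<open>\<mu>\<close> on \<open>C\<close> to
  \<open>\<mu> (g a)\<close>.\<close>

lemma beta_natural:
  fixes A :: "('l::finite_distrib_lattice, 'a) vl_struct" and C :: "('l, 'c) vl_struct"
  assumes nt: "(bot::'l) \<noteq> top" and A: "vl_alg A" and C: "vl_alg C" and g: "g \<in> vhom A C"
    and a: "a \<in> vcarrier A"
  shows "Fmor (Gobj C) (Gobj A) (Gmor A C g) (beta A a) = beta C (g a)"
proof -
  interpret A: vl_algebra A using nt A by unfold_locales
  interpret C: vl_algebra C using nt C by unfold_locales
  have "Gmor A C g \<mu> \<in> vhom A L_alg" if "\<mu> \<in> vhom C L_alg" for \<mu>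
    using comp_vhom[OF A g that nt] that by (simp add: Gmor_def)
  then show ?thesis
    using a A.beta_carrier[OF a] vhomD(2)[OF g a]
    by (auto simp: Fmor_def C.pspace_Gobj A.beta_apply C.beta_apply restrict_eq_restrict_iff)
       (simp add: Gmor_def)
qed

text \<open>Both sides send a morphism \<open>\<psi>\<close> on \<open>D\<close> to
  \<open>\<psi> (\<phi> s)\<close>.\<close>

lemma zeta_natural:
  fixes B :: "('l::finite_distrib_lattice, 'b) pbs" and D :: "('l, 'd) pbs"
  assumes nt: "(bot::'l) \<noteq> top" and B: "pbs_obj B" and D: "pbs_obj D" and \<phi>: "\<phi> \<in> pbs_hom B D"
    and s: "s \<in> pspace B"
  shows "Gmor (Fobj D) (Fobj B) (Fmor B D \<phi>) (zeta B s) = zeta D (\<phi> s)"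
proof -
  interpret B: pbs_space B using nt B by unfold_locales
  interpret D: pbs_space D using nt D by unfold_locales
  have \<phi>s: "\<phi> s \<in> pspace D" using \<phi> s by (auto simp: pbs_hom_def)
  have "Fmor B D \<phi> \<psi> \<in> pbs_hom B L_pbs" if "\<psi> \<in> pbs_hom D L_pbs" for \<psi>
    using vhomD(2)[OF Fmor_vhom[OF nt B D \<phi>], of \<psi>] that by simp
  then show ?thesis
    using s \<phi>s B.zeta_in_vhom[OF s]
    by (auto simp: Gmor_def B.zeta_apply D.zeta_apply restrict_eq_restrict_iff) (simp add: Fmor_def)
qed

theorem theorem1:
  assumes nontriv: "(bot::'l::finite_distrib_lattice) \<noteq> top"
  shows
  "\<comment> \<open>G is a functor VA_L \<rightarrow> PBS_L (contravariant)\<close>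
   (\<forall>A :: ('l, 'a) vl_struct. vl_alg A \<longrightarrow> pbs_obj (Gobj A)) \<and>
   (\<forall>(A :: ('l, 'a) vl_struct) (C :: ('l, 'c) vl_struct) g.
      vl_alg A \<and> vl_alg C \<and> g \<in> vhom A C \<longrightarrow> Gmor A C g \<in> pbs_hom (Gobj C) (Gobj A)) \<and>
   (\<forall>A :: ('l, 'a) vl_struct. vl_alg A \<longrightarrow>
      (\<forall>\<mu>\<in>pspace (Gobj A). Gmor A A (\<lambda>x\<in>vcarrier A. x) \<mu> = \<mu>)) \<and>
   (\<forall>(A :: ('l, 'a) vl_struct) (C :: ('l, 'c) vl_struct) (E :: ('l, 'e) vl_struct) g h.
      vl_alg A \<and> vl_alg C \<and> vl_alg E \<and> g \<in> vhom A C \<and> h \<in> vhom C E \<longrightarrow>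
      (\<forall>\<mu>\<in>pspace (Gobj E).
         Gmor A E (compose (vcarrier A) h g) \<mu> = Gmor A C g (Gmor C E h \<mu>))) \<and>
   \<comment> \<open>F is a functor PBS_L \<rightarrow> VA_L (contravariant)\<close>
   (\<forall>B :: ('l, 'b) pbs. pbs_obj B \<longrightarrow> vl_alg (Fobj B)) \<and>
   (\<forall>(B :: ('l, 'b) pbs) (D :: ('l, 'd) pbs) \<phi>.
      pbs_obj B \<and> pbs_obj D \<and> \<phi> \<in> pbs_hom B D \<longrightarrow> Fmor B D \<phi> \<in> vhom (Fobj D) (Fobj B)) \<and>
   (\<forall>B :: ('l, 'b) pbs. pbs_obj B \<longrightarrow>
      (\<forall>\<eta>\<in>vcarrier (Fobj B). Fmor B B (\<lambda>x\<in>pspace B. x) \<eta> = \<eta>)) \<and>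
   (\<forall>(B :: ('l, 'b) pbs) (D :: ('l, 'd) pbs) (E :: ('l, 'f) pbs) \<phi> \<psi>.
      pbs_obj B \<and> pbs_obj D \<and> pbs_obj E \<and> \<phi> \<in> pbs_hom B D \<and> \<psi> \<in> pbs_hom D E \<longrightarrow>
      (\<forall>\<eta>\<in>vcarrier (Fobj E).
         Fmor B E (compose (pspace B) \<psi> \<phi>) \<eta> = Fmor B D \<phi> (Fmor D E \<psi> \<eta>))) \<and>
   \<comment> \<open>beta is a natural isomorphism Id \<rightarrow> F G\<close>
   (\<forall>A :: ('l, 'a) vl_struct. vl_alg A \<longrightarrow>
      beta A \<in> vhom A (Fobj (Gobj A)) \<and>
      bij_betw (beta A) (vcarrier A) (vcarrier (Fobj (Gobj A)))) \<and>
   (\<forall>(A :: ('l, 'a) vl_struct) (C :: ('l, 'c) vl_struct) g.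
      vl_alg A \<and> vl_alg C \<and> g \<in> vhom A C \<longrightarrow>
      (\<forall>a\<in>vcarrier A. Fmor (Gobj C) (Gobj A) (Gmor A C g) (beta A a) = beta C (g a))) \<and>
   \<comment> \<open>zeta is a natural isomorphism Id \<rightarrow> G F, a bi-homeomorphism\<close>
   (\<forall>B :: ('l, 'b) pbs. pbs_obj B \<longrightarrow>
      zeta B \<in> pbs_hom B (Gobj (Fobj B)) \<and>
      bij_betw (zeta B) (pspace B) (pspace (Gobj (Fobj B))) \<and>
      homeomorphic_map (ptop1 B) (ptop1 (Gobj (Fobj B))) (zeta B) \<and>
      homeomorphic_map (ptop2 B) (ptop2 (Gobj (Fobj B))) (zeta B) \<and>
      (\<exists>\<theta>\<in>pbs_hom (Gobj (Fobj B)) B.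
         (\<forall>s\<in>pspace B. \<theta> (zeta B s) = s) \<and>
         (\<forall>y\<in>pspace (Gobj (Fobj B)). zeta B (\<theta> y) = y))) \<and>
   (\<forall>(B :: ('l, 'b) pbs) (D :: ('l, 'd) pbs) \<phi>.
      pbs_obj B \<and> pbs_obj D \<and> \<phi> \<in> pbs_hom B D \<longrightarrow>
      (\<forall>s\<in>pspace B. Gmor (Fobj D) (Fobj B) (Fmor B D \<phi>) (zeta B s) = zeta D (\<phi> s)))"
proof -
  note A = vl_algebra.intro[OF nontriv] and B = pbs_space.intro[OF nontriv]
  show ?thesis
    apply (intro conjI allI impI ballI; (elim conjE)?)
    subgoal by (rule vl_algebra.pbs_obj_Gobj[OF A])
    subgoal by (rule Gmor_pbs_hom[OF nontriv])
    subgoal by (simp add: vl_algebra.pspace_Gobj[OF A] Gmor_id)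
    subgoal by (simp add: vl_algebra.pspace_Gobj[OF A] Gmor_compose[OF _ _ _ _ nontriv])
    subgoal by (rule pbs_space.vl_alg_Fobj[OF B])
    subgoal by (rule Fmor_vhom[OF nontriv])
    subgoal by (simp add: Fmor_id)
    subgoal by (simp add: Fmor_compose[OF nontriv])
    subgoal by (rule vl_algebra.beta_hom[OF A])
    subgoal by (rule vl_algebra.beta_bij[OF A])
    subgoal by (rule beta_natural[OF nontriv])
    subgoal by (rule pbs_space.zeta_pbs_hom[OF B])
    subgoal by (simp add: bij_betw_def pbs_space.zeta_inj[OF B] pbs_space.zeta_image[OF B])
    subgoal by (rule pbs_space.zeta_homeomorphic[OF B])
    \<comment> \<open>On both sides the second topology equals the first, so this is the previous
      homeomorphism again.\<close>
    subgoal by (simp add: pbs_space.ptop2_eq[OF B] pbs_space.zeta_homeomorphic[OF B]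
          vl_algebra.ptop2_Gobj[OF A] pbs_space.vl_alg_Fobj[OF B])
    subgoal by (rule pbs_space.zeta_inverse[OF B])
    subgoal by (rule zeta_natural[OF nontriv])
    done
qed

end
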